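(* Let $(n_i)_{i\ge 1}$ and $(k_i)_{i\ge 1}$ be sequences of real numbers with $1\le k_i\le n_i$ for all $i$, such that $\lim_{i\to\infty} n_i=\infty$ and \[ \lim_{i\to\infty}\frac{n_i}{k_i}=\alpha<\infty . \] Then \[ \lim_{i\to\infty}\lambda_{k_i,n_i}=\frac{\alpha^{\alpha+1}}{(\alpha-1)^{\alpha-1}}\left(\frac{2}{\alpha}\right)^{\frac{2}{2-\alpha}}, \] where for $\alpha=1$ (resp. $\alpha=2$) the right-hand side is understood as the limit of the expression as $\alpha\to1$ (resp. $\alpha\to 2$), which is $4$ (resp. $8e$). Here $\lambda_{k,n}$ is the first radial $(k,n)$-eigenvalue.
   Context: For real $0\le k\le n$, $\binom{n}{k}:=\frac{\Gamma(n+1)}{\Gamma(k+1)\Gamma(n-k+1)}$. For $\alpha\ge 1$, a function $u\in C^2(0,1)$ is called $\alpha$-convex if $\limsup_{r\to0}\frac{u'}{r}<\infty$, $u'\ge0$ and $u''+(\alpha-1)\frac{u'}{r}\ge0$ on $(0,1)$. For real $1\le k\le n$, set $\alpha=n/k$ and $S_{k,n}(u):=\binom{n-1}{k-1}\left(\frac{u'}{r}\right)^{k-1}\left(u''+\frac{n-k}{k}\frac{u'}{r}\right)$. An $\alpha$-convex function $u$ and a number $\lambda>0$ solve the radial $(k,n)$-eigenvalue problem if $S_{k,n}(u)=(-\lambda u)^k$ on $(0,1)$, $u(0)=-1$, $u(1)=0$ (endpoint values taken as limits). It is known that there is a unique such pair, denoted $(u_{k,n},\lambda_{k,n})$: the first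 radial $(k,n)$-eigenfunction and eigenvalue. It is also known that $\lambda_{k,n}^k=\inf\frac{E_{k,n}[u]}{I_{k,n}[u]}$, the infimum being over $\alpha$-convex $u$ with $u(1)=0$, $u(0)=-1$, where $E_{k,n}[u]=\frac1{k+1}\int_0^1(-u)S_{k,n}(u)\,r^{n-1}dr$ and $I_{k,n}[u]=\frac1{k+1}\int_0^1(-u)^{k+1}r^{n-1}dr$; the infimum is attained by $u_{k,n}$. For integer $k,n$, $\lambda_{k,n}$ is the first eigenvalue of the $k$-Hessian operator (the $k$-th elementary symmetric polynomial of the eigenvalues of the Hessian) on the unit ball of $\mathbb{R}^n$. *)

theory Defs
  imports "HOL-Analysis.Analysis" "HOL-Real_Asymp.Real_Asymp"
begin

definition real_binom :: "real \<Rightarrow> real \<Rightarrow> real" where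
  "real_binom n k = Gamma (n + 1) / (Gamma (k + 1) * Gamma (n - k + 1))"

text \<open>
  Real powers of nonnegative bases with the convention \<open>x\<^sup>0 = 1\<close> also for \<open>x = 0\<close>, whereas
  \<open>0 powr 0 = 0\<close>. This matters for the factor \<open>(u'/r)\<^bsup>k-1\<^esup>\<close> when \<open>k = 1\<close>.
\<close>
definition rpow :: "real \<Rightarrow> real \<Rightarrow> real" where
  "rpow x a = (if a = 0 then 1 else x powr a)"

definition C2_on :: "real set \<Rightarrow> (real \<Rightarrow> real) \<Rightarrow> bool" where
  "C2_on S u \<longleftrightarrow>
     u differentiable_on S \<and> deriv u differentiable_on S \<and> continuous_on S (deriv (deriv u))"

definition alpha_convex :: "real \<Rightarrow> (real \<Rightarrow> real) \<Rightarrow> bool" where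
  "alpha_convex \<alpha> u \<longleftrightarrow>
     C2_on {0<..<1} u \<and>
     Limsup (at_right 0) (\<lambda>r. ereal (deriv u r / r)) < \<infinity> \<and>
     (\<forall>r\<in>{0<..<1}. deriv u r \<ge> 0 \<and> deriv (deriv u) r + (\<alpha> - 1) * (deriv u r / r) \<ge> 0)"

definition radial_hessian :: "real \<Rightarrow> real \<Rightarrow> (real \<Rightarrow> real) \<Rightarrow> real \<Rightarrow> real" where
  "radial_hessian k n u r =
     real_binom (n - 1) (k - 1) * rpow (deriv u r / r) (k - 1) *
       (deriv (deriv u) r + (n - k) / k * (deriv u r / r))"

text \<open>
  Only the restriction of \<open>u\<close> to the open interval \<open>(0,1)\<close> is relevant; the boundary values are
  one-sided limits.
\<close>
definition radial_eigenpair :: "real \<Rightarrow> real \<Rightarrow> (real \<Rightarrow> real) \<Rightarrow> real \<Rightarrow> bool" where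
  "radial_eigenpair k n u l \<longleftrightarrow>
     alpha_convex (n / k) u \<and> l > 0 \<and>
     (\<forall>r\<in>{0<..<1}. radial_hessian k n u r = rpow (- l * u r) k) \<and>
     (u \<longlongrightarrow> -1) (at_right 0) \<and> (u \<longlongrightarrow> 0) (at_left 1)"

definition radial_eigenvalue :: "real \<Rightarrow> real \<Rightarrow> real" where
  "radial_eigenvalue k n = (THE l. \<exists>u. radial_eigenpair k n u l)"

definition limit_expr :: "real \<Rightarrow> real" where
  "limit_expr \<alpha> =
     \<alpha> powr (\<alpha> + 1) / (\<alpha> - 1) powr (\<alpha> - 1) * (2 / \<alpha>) powr (2 / (2 - \<alpha>))"

definition limit_value :: "real \<Rightarrow> real" where
  "limit_value \<alpha> =
     (if \<alpha> = 1 then 4 else if \<alpha> = 2 then 8 * exp 1 else limit_expr \<alpha>)"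

lemma limit_expr_tendsto_1: "(limit_expr \<longlongrightarrow> 4) (at_right 1)"
proof -
  have "exp (ln 2 * 2) = (2 :: real) powr 2" by (simp add: powr_def mult.commute)
  then have "exp (ln 2 * 2) = (4 :: real)" by simp
  then show ?thesis unfolding limit_expr_def by real_asymp
qed

lemma limit_expr_tendsto_2: "(limit_expr \<longlongrightarrow> 8 * exp 1) (at 2)"
proof -
  have "exp (ln 2 * 3) = (2 :: real) powr 3" by (simp add: powr_def mult.commute)
  then have "exp (ln 2 * 3) = (8 :: real)" by simp
  then show ?thesis unfolding limit_expr_def by real_asymp
qed

end

theory Submission imports Defs begin

text \<open>
  Put \<open>a = n/k\<close> and \<open>c = binom (n - 1) (k - 1)\<close>. For an eigenpair \<open>(u, \<lambda>)\<close> the function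
  \<open>y = u' / (- r u)\<close> solves the Riccati equation
  \<open>r y' = M\<^sup>k y\<^bsup>1-k\<^esup> - a y + r\<^sup>2 y\<^sup>2\<close> with \<open>M = \<lambda> / c\<^bsup>1/k\<^esup>\<close>; it is bounded near \<open>0\<close> and blows
  up at \<open>1\<close>. For large \<open>k\<close> the term \<open>M\<^sup>k y\<^bsup>1-k\<^esup>\<close> acts as an obstacle forcing \<open>y \<ge> M\<close> and is negligible
  above it, where \<open>z = 1/y\<close> satisfies the linear equation \<open>r z' = a z - r\<^sup>2\<close> with \<open>z(1) = 0\<close>, so that
  \<open>z = G\<^sub>a(r) = r\<^sup>a \<integral>\<^sub>r\<^sup>1 s\<^bsup>1-a\<^esup> ds\<close>. Making both halves quantitative gives \<open>a\<^bsup>1/k\<^esup> / M \<ge> max G\<^sub>a\<close> and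
  \<open>1 / ((1 + \<eta>) M) \<le> max G\<^sub>b\<close> for \<open>b = a - (1 + \<eta>)\<^bsup>-k\<^esup>\<close>, hence \<open>1/M \<rightarrow> max G\<^sub>\<alpha>\<close>. The limit of
  \<open>c\<^bsup>1/k\<^esup>\<close> follows from a crude Stirling estimate.

  Uniqueness of \<open>\<lambda>\<close> holds because \<open>y\<close> is determined by \<open>M\<close> and \<open>M\<close> can be normalised by scaling. For
  existence, the integrated equation is a Volterra equation whose nonlinearity is an \<open>L\<^sup>k\<close>-mean, hence
  Lipschitz in the supremum norm, so Picard iteration converges; the solution must reach zero since the
  upper bound on \<open>M\<close> bounds the radius on which it is positive.
\<close>

section \<open>The Riccati equation\<close>

definition riccati_solution :: "real \<Rightarrow> real \<Rightarrow> real \<Rightarrow> (real \<Rightarrow> real) \<Rightarrow> bool" where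
  "riccati_solution k a M y \<longleftrightarrow>
     (\<forall>r\<in>{0<..<1}. 0 < y r \<and>
        (y has_real_derivative (M powr k * y r powr (1 - k) - a * y r + r\<^sup>2 * (y r)\<^sup>2) / r) (at r))"

section \<open>The equation without forcing and its critical constants\<close>

text \<open>Normalised to vanish at 1, so that \<open>- (r powr b) * powr_primitive b r\<close> is
  the function \<open>G\<^sub>b\<close>, the solution of \<open>r z' = b z - r\<^sup>2\<close> with
  \<open>z(1) = 0\<close>.\<close>

definition powr_primitive :: "real \<Rightarrow> real \<Rightarrow> real" where
  "powr_primitive b r = (if b = 2 then ln r else (r powr (2 - b) - 1) / (2 - b))"

text \<open>Minus the logarithm of the point where \<open>G\<^sub>b\<close> is maximal. The value
  1/2 is the limit of the quotient as b tends to 2.\<close>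

definition critical_exponent :: "real \<Rightarrow> real" where
  "critical_exponent b = (if b = 2 then 1 / 2 else ln (2 / b) / (2 - b))"

definition critical_radius :: "real \<Rightarrow> real" where
  "critical_radius b = exp (- critical_exponent b)"

text \<open>The reciprocal of the maximum of \<open>G\<^sub>b\<close>: at a stationary point the
  equation \<open>r z' = b z - r\<^sup>2\<close> reduces to
  \<open>z = r\<^sup>2 / b\<close>.\<close>

definition critical_rate :: "real \<Rightarrow> real" where
  "critical_rate b = b / (critical_radius b)\<^sup>2"

lemma powr_primitive_1 [simp]: "powr_primitive b 1 = 0"
  by (simp add: powr_primitive_def)

lemma DERIV_powr_primitive:
  assumes "r > 0"
  shows "(powr_primitive b has_real_derivative r powr (1 - b)) (at r)"
proof (cases "b = 2")
  case True
  have "(ln has_real_derivative r powr (1 - b)) (at r)"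
    using assms True by (auto intro!: derivative_eq_intros simp: powr_minus divide_simps)
  moreover have "powr_primitive b = ln" using True by (auto simp: powr_primitive_def)
  ultimately show ?thesis by simp
next
  case False
  have "((\<lambda>r. (r powr (2 - b) - 1) / (2 - b)) has_real_derivative r powr (1 - b)) (at r)"
    using assms False by (auto intro!: derivative_eq_intros)
  moreover have "powr_primitive b = (\<lambda>r. (r powr (2 - b) - 1) / (2 - b))"
    using False by (auto simp: powr_primitive_def)
  ultimately show ?thesis by simp
qed

lemma critical_exponent_pos:
  assumes "b > 0"
  shows "critical_exponent b > 0"
proof -
  consider "b = 2" | "b < 2" | "b > 2" by linarith
  then show ?thesis
  proof cases
    case 2
    then have "ln (2 / b) > 0" using assms by simp
    then show ?thesis using 2 by (simp add: critical_exponent_def)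
  next
    case 3
    then have "ln (2 / b) < 0" using assms by simp
    then show ?thesis using 3 by (simp add: critical_exponent_def divide_neg_neg)
  qed (simp add: critical_exponent_def)
qed

lemma critical_radius_bounds:
  assumes "b > 0"
  shows "0 < critical_radius b" "critical_radius b < 1"
  using critical_exponent_pos[OF assms] by (auto simp: critical_radius_def)

lemma critical_radius_powr:
  assumes "b > 0"
  shows "critical_radius b powr (2 - b) = b / 2"
proof (cases "b = 2")
  case False
  have "critical_radius b powr (2 - b) = exp (- ln (2 / b))"
    using False by (simp add: critical_radius_def critical_exponent_def powr_def)
  also have "\<dots> = b / 2" using assms by (simp add: exp_minus)
  finally show ?thesis .
qed (simp add: critical_radius_def)

lemma powr_primitive_critical_radius:
  assumes "b > 0"
  shows "powr_primitive b (critical_radius b) = - 1 / 2"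
proof (cases "b = 2")
  case True
  then show ?thesis
    by (simp add: powr_primitive_def critical_radius_def critical_exponent_def)
next
  case False
  then show ?thesis
    using critical_radius_powr[OF assms] by (simp add: powr_primitive_def field_simps)
qed

lemma critical_rate_pos: "b > 0 \<Longrightarrow> critical_rate b > 0"
  using critical_radius_bounds[of b] by (simp add: critical_rate_def)

text \<open>The maximum of \<open>-r\<^sup>b P(r)\<close>, with \<open>P\<close> the primitive, is attained at the critical radius.\<close>

lemma powr_primitive_at_critical:
  assumes "b > 0"
  shows "critical_radius b powr (- b) / critical_rate b
           + powr_primitive b (critical_radius b) = 0"
proof -
  let ?r = "critical_radius b"
  have r: "?r > 0" using critical_radius_bounds assms by blast
  have "?r powr (2 - b) = ?r\<^sup>2 * ?r powr (- b)"
    using r by (simp add: powr_diff powr_minus divide_inverse)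
  then have "?r\<^sup>2 * ?r powr (- b) = b / 2" using critical_radius_powr[OF assms] by simp
  then have "?r powr (- b) / critical_rate b = 1 / 2"
    using assms r by (simp add: critical_rate_def mult.commute)
  then show ?thesis using powr_primitive_critical_radius[OF assms] by linarith
qed

text \<open>The derivative of the left side has the sign of \<open>s\<^sup>2 - R\<^sup>2\<close>
  with R the critical radius, so the minimum is attained at R, where the value is 0. After
  multiplication by \<open>r powr b\<close> this bounds \<open>G\<^sub>b\<close> by
  \<open>1 / critical_rate b\<close>.\<close>

lemma powr_primitive_lower_bound:
  assumes "b > 0" "r > 0"
  shows "r powr (- b) / critical_rate b + powr_primitive b r \<ge> 0"
proof -
  define \<Phi> where "\<Phi> r = r powr (- b) / critical_rate b + powr_primitive b r" for r
  let ?R = "critical_radius b"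
  have R: "?R > 0" using critical_radius_bounds assms by blast
  have D: "(\<Phi> has_real_derivative s powr (- b - 1) * (s\<^sup>2 - ?R\<^sup>2)) (at s)" if "s > 0" for s
  proof -
    have "(\<Phi> has_real_derivative - b * s powr (- b - 1) / critical_rate b + s powr (1 - b)) (at s)"
      unfolding \<Phi>_def using that critical_rate_pos[OF assms(1)]
      by (auto intro!: derivative_eq_intros DERIV_powr_primitive)
    moreover have "s powr (1 - b) = s powr (- b - 1) * s\<^sup>2"
      using that powr_add[of s "-b-1" 2] by simp
    ultimately show ?thesis
      using assms R by (simp add: critical_rate_def field_simps)
  qed
  have "\<Phi> ?R \<le> \<Phi> r"
  proof (cases "?R \<le> r")
    case True
    show ?thesis
    proof (rule DERIV_nonneg_imp_nondecreasing[OF True])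
      fix x assume "?R \<le> x" "x \<le> r"
      then show "\<exists>y. (\<Phi> has_real_derivative y) (at x) \<and> 0 \<le> y"
        using R D[of x] power_mono[of ?R x 2] by (intro exI[of _ "x powr (- b - 1) * (x\<^sup>2 - ?R\<^sup>2)"]) auto
    qed
  next
    case False
    show ?thesis
    proof (rule DERIV_nonpos_imp_nonincreasing[of r ?R \<Phi>])
      show "r \<le> ?R" using False by simp
      fix x assume "r \<le> x" "x \<le> ?R"
      then show "\<exists>y. (\<Phi> has_real_derivative y) (at x) \<and> y \<le> 0"
        using assms D[of x] power_mono[of x ?R 2]
        by (intro exI[of _ "x powr (- b - 1) * (x\<^sup>2 - ?R\<^sup>2)"]) (auto intro!: mult_nonneg_nonpos)
    qed
  qed
  then show ?thesis using powr_primitive_at_critical[OF assms(1)] by (simp add: \<Phi>_def)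
qed

text \<open>The singularity at 2 is removable; this lets ratios n/k that tend to 2 be treated like
  all others.\<close>

lemma continuous_critical_exponent:
  assumes "b > 0"
  shows "isCont critical_exponent b"
proof (cases "b = 2")
  case True
  have "((\<lambda>b::real. ln (2 / b) / (2 - b)) \<longlongrightarrow> 1 / 2) (at 2)" by real_asymp
  moreover have "eventually (\<lambda>b. ln (2 / b) / (2 - b) = critical_exponent b) (at 2)"
    by (auto simp: critical_exponent_def eventually_at_filter)
  ultimately have "(critical_exponent \<longlongrightarrow> 1 / 2) (at 2)"
    by (rule Lim_transform_eventually)
  then show ?thesis using True by (simp add: isCont_def critical_exponent_def)
next
  case False
  have "isCont (\<lambda>b. ln (2 / b) / (2 - b)) b"
    using assms False by (intro continuous_intros) auto
  moreover have "eventually (\<lambda>x. critical_exponent x = ln (2 / x) / (2 - x)) (nhds b)"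
    using t1_space_nhds[OF False] by eventually_elim (auto simp: critical_exponent_def)
  ultimately show ?thesis by (simp add: isCont_cong)
qed

lemma continuous_critical_rate:
  assumes "b > 0"
  shows "isCont critical_rate b"
  unfolding critical_rate_def critical_radius_def
  using continuous_critical_exponent[OF assms] by (intro continuous_intros) auto

section \<open>Comparison with the equation without forcing: two-sided bounds on M\<close>

lemma riccati_solution_isCont:
  "riccati_solution k a M y \<Longrightarrow> 0 < r \<Longrightarrow> r < 1 \<Longrightarrow> isCont y r"
  unfolding riccati_solution_def by (meson DERIV_isCont greaterThanLessThan_iff)

text \<open>With \<open>z = 1 / y\<close> the equation becomes
  \<open>r z' = (a - (M / y) powr k) * z - r\<^sup>2\<close>, and \<open>r powr (- b)\<close> is the
  integrating factor for exponent b. The free exponent serves both bounds: \<open>b = a\<close>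
  makes the derivative nonpositive, a slightly smaller b makes it nonnegative wherever y is well
  above M.\<close>

lemma DERIV_riccati_inverse:
  assumes y: "riccati_solution k a M y" and "0 < r" "r < 1" "M > 0"
  shows "((\<lambda>r. r powr (- b) / y r + powr_primitive b r) has_real_derivative
            r powr (- b - 1) * (a - b - (M / y r) powr k) / y r) (at r)"
proof -
  have pos: "y r > 0" using y assms by (auto simp: riccati_solution_def)
  let ?D = "(M powr k * y r powr (1 - k) - a * y r + r\<^sup>2 * (y r)\<^sup>2) / r"
  have D: "(y has_real_derivative ?D) (at r)"
    using y assms by (auto simp: riccati_solution_def)
  have "((\<lambda>r. r powr (- b) / y r + powr_primitive b r) has_real_derivative
     (- b * r powr (- b - 1) * y r - r powr (- b) * ?D) / (y r * y r) + r powr (1 - b)) (at r)"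
    using assms pos by (auto intro!: derivative_eq_intros DERIV_powr_primitive D)
  moreover have "(- b * r powr (- b - 1) * y r - r powr (- b) * ?D) / (y r * y r) + r powr (1 - b) =
      r powr (- b - 1) * (a - b - (M / y r) powr k) / y r"
  proof -
    have 1: "r powr (- b) = r powr (- b - 1) * r" "r powr (1 - b) = r powr (- b - 1) * r\<^sup>2"
      using assms powr_add[of r "-b-1" 1] powr_add[of r "-b-1" 2] by simp_all
    have 2: "M powr k * y r powr (1 - k) = y r * (M / y r) powr k"
      using assms pos by (simp add: powr_diff powr_divide)
    show ?thesis
      unfolding 1 2 using assms pos by (simp add: divide_simps power2_eq_square) algebra
  qed
  ultimately show ?thesis by (rule DERIV_cong)
qed

text \<open>The obstacle in quantitative form. Multiplied by \<open>k * y powr (k - 1)\<close> the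
  equation is linear in \<open>y powr k\<close> apart from a nonnegative term, and
  \<open>r powr (a * k)\<close> is its integrating factor.\<close>

lemma riccati_lower_bound:
  assumes y: "riccati_solution k a M y" and "k > 0" "a > 0" "0 < r" "r < 1"
  shows "M powr k \<le> a * y r powr k"
proof -
  define F where "F r = r powr (a * k) * (a * y r powr k - M powr k)" for r
  have D: "(F has_real_derivative a * k * s powr (a * k + 1) * y s powr (k + 1)) (at s)"
    if s: "0 < s" "s < 1" for s
  proof -
    have pos: "y s > 0" using y s by (auto simp: riccati_solution_def)
    let ?D = "(M powr k * y s powr (1 - k) - a * y s + s\<^sup>2 * (y s)\<^sup>2) / s"
    have D: "(y has_real_derivative ?D) (at s)"
      using y s by (auto simp: riccati_solution_def)
    have "(F has_real_derivative a * k * s powr (a * k - 1) * (a * y s powr k - M powr k) +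
       a * (k * y s powr (k - 1) * ?D) * s powr (a * k)) (at s)"
      unfolding F_def
      by (rule derivative_eq_intros DERIV_fun_powr D refl | use s pos in simp)+
    moreover have "a * k * s powr (a * k - 1) * (a * y s powr k - M powr k) +
       a * (k * y s powr (k - 1) * ?D) * s powr (a * k) =
       a * k * s powr (a * k + 1) * y s powr (k + 1)"
    proof -
      have 1: "s powr (a * k) = s powr (a * k - 1) * s" "s powr (a * k + 1) = s powr (a * k - 1) * s\<^sup>2"
        using s powr_add[of s "a*k-1" 1] powr_add[of s "a*k-1" 2] by (simp_all add: add.commute)
      have 2: "y s powr (1 - k) = 1 / y s powr (k - 1)"
          "y s powr k = y s powr (k - 1) * y s" "y s powr (k + 1) = y s powr (k - 1) * (y s)\<^sup>2"
        using pos powr_minus_divide[of "y s" "k-1"] powr_add[of "y s" "k-1" 1] powr_add[of "y s" "k-1" 2]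
        by (simp_all add: add.commute)
      show ?thesis
        unfolding 1 2 using s pos by (simp add: divide_simps power2_eq_square) algebra
    qed
    ultimately show ?thesis by (rule DERIV_cong)
  qed
  \<comment> \<open>Positivity of y alone bounds \<open>F s\<close> from below by a quantity that
    tends to 0 with s.\<close>
  have "- (M powr k * s powr (a * k)) \<le> F r" if s: "0 < s" "s < r" for s
  proof -
    have "F s \<le> F r"
    proof (rule DERIV_nonneg_imp_nondecreasing[of s r F])
      show "s \<le> r" using s by simp
      fix x assume "s \<le> x" "x \<le> r"
      then show "\<exists>y. (F has_real_derivative y) (at x) \<and> 0 \<le> y"
        using D[of x] s assms by (intro exI conjI) auto
    qed
    moreover have "F s \<ge> - (M powr k * s powr (a * k))"
      using assms by (simp add: F_def algebra_simps)
    ultimately show ?thesis by linarith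
  qed
  then have "eventually (\<lambda>s. - (M powr k * s powr (a * k)) \<le> F r) (at_right 0)"
    using assms by (auto simp: eventually_at_right_field)
  moreover have "((\<lambda>s. - (M powr k * s powr (a * k))) \<longlongrightarrow> - (M powr k * 0 powr (a * k))) (at_right 0)"
    using assms by (intro tendsto_intros) (auto simp: eventually_at_filter)
  ultimately have "0 \<le> F r"
    by (simp add: tendsto_upperbound)
  then show ?thesis using assms by (simp add: F_def zero_le_mult_iff)
qed

text \<open>For \<open>b = a\<close> the function F decreases towards 1 and stays above the
  primitive, which tends to 0 there. Hence F is nonnegative at the critical radius, which gives
  \<open>y \<le> critical_rate a\<close> at that point; the obstacle bound converts this into a
  bound on M. Only positivity of y on the whole interval enters, so the bound also applies to a
  Volterra solution not yet known to reach zero.\<close>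

lemma riccati_rate_le:
  assumes y: "riccati_solution k a M y" and "k > 0" "a > 0" "M > 0"
  shows "M \<le> a powr (1 / k) * critical_rate a"
proof -
  let ?r = "critical_radius a"
  have r: "0 < ?r" "?r < 1" using critical_radius_bounds assms by auto
  have pos: "y s > 0" if "0 < s" "s < 1" for s using y that by (auto simp: riccati_solution_def)
  define F where "F r = r powr (- a) / y r + powr_primitive a r" for r
  have "powr_primitive a s \<le> F ?r" if s: "?r < s" "s < 1" for s
  proof -
    have "F s \<le> F ?r"
    proof (rule DERIV_nonpos_imp_nonincreasing[of ?r s F])
      show "?r \<le> s" using s by simp
      fix x assume x: "?r \<le> x" "x \<le> s"
      have "(F has_real_derivative x powr (- a - 1) * (a - a - (M / y x) powr k) / y x) (at x)"
        unfolding F_def using x r s assms by (intro DERIV_riccati_inverse[OF y]) auto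
      moreover have "x powr (- a - 1) * (a - a - (M / y x) powr k) / y x \<le> 0"
        using pos[of x] x r s by (simp add: divide_nonneg_pos)
      ultimately show "\<exists>y. (F has_real_derivative y) (at x) \<and> y \<le> 0" by blast
    qed
    moreover have "F s \<ge> powr_primitive a s" using pos[of s] s r by (simp add: F_def)
    ultimately show ?thesis by linarith
  qed
  then have "eventually (\<lambda>s. powr_primitive a s \<le> F ?r) (at_left 1)"
    using r by (auto simp: eventually_at_left_field)
  moreover have "(powr_primitive a \<longlongrightarrow> powr_primitive a 1) (at_left 1)"
    using DERIV_isCont[OF DERIV_powr_primitive[of 1 a]]
    by (auto simp: isCont_def intro: tendsto_within_subset)
  ultimately have "0 \<le> F ?r"
    by (simp add: tendsto_upperbound)
  with powr_primitive_at_critical[of a] have "?r powr (- a) / critical_rate a \<le> ?r powr (- a) / y ?r"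
    using assms by (simp add: F_def)
  then have "1 / critical_rate a \<le> 1 / y ?r"
    using r by (simp add: divide_inverse)
  then have "y ?r \<le> critical_rate a"
    using pos[OF r] critical_rate_pos[of a] assms by (simp add: field_simps)
  moreover have "M \<le> a powr (1 / k) * y ?r"
  proof -
    have "(M powr k) powr (1 / k) \<le> (a * y ?r powr k) powr (1 / k)"
      using riccati_lower_bound[OF y _ _ r] assms by (intro powr_mono2) auto
    then show ?thesis using assms pos[OF r] by (simp add: powr_mult powr_powr)
  qed
  ultimately show ?thesis
    by (smt (verit) mult_left_mono powr_ge_zero)
qed

text \<open>\<open>G\<^sub>b\<close> vanishes at 0, so a solution with
  \<open>1 / y \<le> G\<^sub>b\<close> near 0 cannot be bounded there.\<close>

lemma powr_powr_primitive_tendsto_0: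
  assumes "b > 0"
  shows "((\<lambda>r. r powr b * powr_primitive b r) \<longlongrightarrow> 0) (at_right 0)"
proof (cases "b = 2")
  case True
  have "((\<lambda>r::real. r powr 2 * ln r) \<longlongrightarrow> 0) (at_right 0)" by real_asymp
  then show ?thesis using True by (simp add: powr_primitive_def)
next
  case False
  have "((\<lambda>r. (r powr 2 - r powr b) / (2 - b)) \<longlongrightarrow> (0 powr 2 - 0 powr b) / (2 - b)) (at_right 0)"
    using assms False by (intro tendsto_intros) (auto simp: eventually_at_filter)
  then have "((\<lambda>r. (r powr 2 - r powr b) / (2 - b)) \<longlongrightarrow> 0) (at_right 0)" by simp
  moreover have "eventually (\<lambda>r. (r powr 2 - r powr b) / (2 - b) = r powr b * powr_primitive b r) (at_right 0)"
    unfolding eventually_at_filter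
    using False by (intro always_eventually)
      (auto simp: powr_primitive_def right_diff_distrib powr_add[symmetric] simp del: powr_numeral)
  ultimately show ?thesis by (rule Lim_transform_eventually)
qed

text \<open>Once \<open>y \<ge> (1 + \<eta>) M\<close>, the forcing term costs at most \<open>(1 + \<eta>) powr - k\<close> in the exponent.\<close>

lemma riccati_inverse_le_above:
  assumes y: "riccati_solution k a M y" and "k > 0" "M > 0" "\<eta> > 0"
    and blowup: "filterlim y at_top (at_left 1)"
    and b: "b = a - (1 + \<eta>) powr (- k)"
    and r: "0 < r" "r < 1" and above: "\<And>s. r < s \<Longrightarrow> s < 1 \<Longrightarrow> (1 + \<eta>) * M \<le> y s"
  shows "r powr (- b) / y r + powr_primitive b r \<le> 0"
proof -
  have pos: "y s > 0" if "0 < s" "s < 1" for s using y that by (auto simp: riccati_solution_def)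
  define F where "F r = r powr (- b) / y r + powr_primitive b r" for r
  have D: "(F has_real_derivative x powr (- b - 1) * (a - b - (M / y x) powr k) / y x) (at x)"
    if "0 < x" "x < 1" for x
    unfolding F_def using that assms by (intro DERIV_riccati_inverse[OF y]) auto
  have cont: "isCont F x" if "0 < x" "x < 1" for x using D[OF that] by (rule DERIV_isCont)
  have "F r \<le> F s" if s: "r < s" "s < 1" for s
  proof (rule DERIV_nonneg_imp_increasing_open[of r s F])
    show "r \<le> s" using s by simp
    fix x assume x: "r < x" "x < s"
    have "M / y x \<le> 1 / (1 + \<eta>)"
      using above[of x] x s assms pos[of x] by (simp add: field_simps)
    then have "(M / y x) powr k \<le> (1 / (1 + \<eta>)) powr k"
      using assms pos[of x] x s by (intro powr_mono2) auto
    also have "\<dots> = a - b" using assms by (simp add: b powr_divide powr_minus_divide)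
    finally have "x powr (- b - 1) * (a - b - (M / y x) powr k) / y x \<ge> 0"
      using pos[of x] x s r by simp
    then show "\<exists>y. (F has_real_derivative y) (at x) \<and> 0 \<le> y"
      using D[of x] x s r by auto
  next
    show "continuous_on {r..s} F"
      using r s by (intro continuous_at_imp_continuous_on ballI cont) auto
  qed
  then have "eventually (\<lambda>s. F r \<le> F s) (at_left 1)"
    using r by (auto simp: eventually_at_left_field)
  moreover have "(F \<longlongrightarrow> 1 powr (- b) * 0 + powr_primitive b 1) (at_left 1)"
    unfolding F_def divide_inverse
  proof (intro tendsto_intros)
    show "((\<lambda>s. inverse (y s)) \<longlongrightarrow> 0) (at_left 1)"
      using blowup by (rule tendsto_inverse_0_at_top)
    show "(powr_primitive b \<longlongrightarrow> powr_primitive b 1) (at_left 1)"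
      using DERIV_isCont[OF DERIV_powr_primitive[of 1 b]]
      by (auto simp: isCont_def intro: tendsto_within_subset)
  qed auto
  ultimately show ?thesis using tendsto_lowerbound[of F 0 "at_left 1" "F r"] by (simp add: F_def)
qed

text \<open>At the last point r with \<open>y r \<le> (1 + \<eta>) * M\<close> the preceding lemma
  gives \<open>1 / y r \<le> G\<^sub>b(r)\<close>, and \<open>G\<^sub>b\<close> is at most
  \<open>1 / critical_rate b\<close>.\<close>

lemma riccati_rate_ge:
  assumes y: "riccati_solution k a M y" and "k > 0" "a \<ge> 1" "M > 0" "\<eta> > 0"
    and blowup: "filterlim y at_top (at_left 1)"
    and bdd: "eventually (\<lambda>r. y r \<le> L) (at_right 0)"
    and b: "b = a - (1 + \<eta>) powr (- k)"
  shows "critical_rate b \<le> (1 + \<eta>) * M"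
proof -
  have "(1 + \<eta>) powr (- k) < (1 + \<eta>) powr 0" using assms by (intro powr_less_mono) auto
  then have b0: "b > 0" using assms by simp
  have pos: "y s > 0" if "0 < s" "s < 1" for s using y that by (auto simp: riccati_solution_def)
  note above = riccati_inverse_le_above[OF y \<open>k > 0\<close> \<open>M > 0\<close> \<open>\<eta> > 0\<close> blowup b]
  \<comment> \<open>If y stayed above the threshold everywhere, \<open>1 / y\<close> would be at
    most \<open>G\<^sub>b\<close> down to 0, against the boundedness of y.\<close>
  have "\<exists>r0. 0 < r0 \<and> r0 < 1 \<and> y r0 \<le> (1 + \<eta>) * M"
  proof (rule ccontr)
    assume "\<not> ?thesis"
    then have *: "(1 + \<eta>) * M \<le> y s" if "0 < s" "s < 1" for s using that by force
    have "1 / y r \<le> - (r powr b * powr_primitive b r)" if "0 < r" "r < 1" for r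
    proof -
      have "r powr b * (r powr (- b) / y r + powr_primitive b r) \<le> 0"
        using above[of r] * that by (intro mult_nonneg_nonpos) auto
      moreover have "r powr b * r powr (- b) = 1" using that by (simp add: powr_add[symmetric])
      ultimately show ?thesis by (simp add: algebra_simps divide_inverse)
    qed
    then have "eventually (\<lambda>r. 1 / y r \<le> - (r powr b * powr_primitive b r)) (at_right 0)"
      by (auto simp: eventually_at_right_field intro: exI[of _ 1])
    moreover have "eventually (\<lambda>r. 0 < y r) (at_right 0)"
      using pos by (auto simp: eventually_at_right_field intro: exI[of _ 1])
    ultimately have "eventually (\<lambda>r. 1 / L \<le> - (r powr b * powr_primitive b r)) (at_right 0)"
      using bdd
    proof eventually_elim
      case (elim r)
      then have "1 / L \<le> 1 / y r" by (simp add: frac_le)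
      with elim show ?case by linarith
    qed
    moreover have "((\<lambda>r. - (r powr b * powr_primitive b r)) \<longlongrightarrow> 0) (at_right 0)"
      using tendsto_minus[OF powr_powr_primitive_tendsto_0[OF b0]] by simp
    ultimately have "1 / L \<le> 0" by (intro tendsto_lowerbound) auto
    moreover obtain r where "y r > 0" "y r \<le> L"
      using eventually_happens'[OF _ eventually_conj[OF \<open>eventually (\<lambda>r. 0 < y r) (at_right 0)\<close> bdd]]
      by auto
    ultimately show False by (simp add: divide_le_0_iff)
  qed
  then obtain r0 where r0: "0 < r0" "r0 < 1" "y r0 \<le> (1 + \<eta>) * M" by blast
  have "eventually (\<lambda>s. y s > (1 + \<eta>) * M) (at_left 1)"
    using blowup by (simp add: filterlim_at_top_dense)
  then obtain c where c: "c < 1" "\<And>s. c < s \<Longrightarrow> s < 1 \<Longrightarrow> y s > (1 + \<eta>) * M"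
    by (auto simp: eventually_at_left_field)
  have "r0 \<le> c" using c(2)[of r0] r0 by (meson not_le)
  \<comment> \<open>Blow-up at 1 excludes points of low y beyond c, so the maximum of this compact
    set is the last point below the threshold.\<close>
  define S where "S = {r0..c} \<inter> y -` {..(1 + \<eta>) * M}"
  have "continuous_on {r0..c} y"
    using r0 c by (intro continuous_at_imp_continuous_on ballI riccati_solution_isCont[OF y]) auto
  then have "closed S" unfolding S_def by (intro continuous_closed_preimage) auto
  then have "compact S" using compact_Int_closed[of "{r0..c}" S] by (simp add: S_def Int_absorb1 flip: Int_assoc)
  moreover have "S \<noteq> {}" using r0 \<open>r0 \<le> c\<close> by (auto simp: S_def)
  ultimately obtain r where r: "r \<in> S" "\<And>s. s \<in> S \<Longrightarrow> s \<le> r"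
    using compact_attains_sup[of S] by auto
  have rb: "0 < r" "r < 1" "y r \<le> (1 + \<eta>) * M" using r(1) r0 c by (auto simp: S_def)
  have "(1 + \<eta>) * M \<le> y s" if "r < s" "s < 1" for s
  proof (rule ccontr)
    assume "\<not> ?thesis"
    moreover from this have "s \<le> c" using c(2)[of s] that by force
    ultimately have "s \<in> S" using that r(1) by (auto simp: S_def)
    then show False using r(2) that by force
  qed
  then have "r powr (- b) / y r + powr_primitive b r \<le> 0"
    using above[of r] rb by blast
  with powr_primitive_lower_bound[OF b0 rb(1)]
  have "r powr (- b) * (1 / y r) \<le> r powr (- b) * (1 / critical_rate b)" by simp
  then have "1 / y r \<le> 1 / critical_rate b" using rb by (subst (asm) mult_le_cancel_left_pos) auto
  then have "critical_rate b \<le> y r"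
    using pos[of r] rb critical_rate_pos[OF b0] by (simp add: field_simps)
  then show ?thesis using rb by linarith
qed

section \<open>Uniqueness of bounded solutions and of the rate\<close>

lemma riccati_solution_bounded:
  assumes y: "riccati_solution k a M y" and bdd: "eventually (\<lambda>r. y r \<le> L) (at_right 0)" and "c < 1"
  shows "\<exists>B. \<forall>r. 0 < r \<and> r \<le> c \<longrightarrow> y r \<le> B"
proof -
  obtain e where e: "e > 0" "\<And>s. 0 < s \<Longrightarrow> s < e \<Longrightarrow> y s \<le> L"
    using bdd by (auto simp: eventually_at_right_field)
  have "continuous_on {e..c} y"
    using e assms by (intro continuous_at_imp_continuous_on ballI riccati_solution_isCont[OF y]) auto
  then have "bounded (y ` {e..c})" by (intro compact_imp_bounded compact_continuous_image) auto
  then obtain B where "\<And>s. s \<in> {e..c} \<Longrightarrow> \<bar>y s\<bar> \<le> B"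
    unfolding bounded_iff by (metis image_eqI real_norm_def)
  then have B: "y s \<le> B" if "s \<in> {e..c}" for s using that abs_le_D1 by blast
  have "y r \<le> max L B" if "0 < r" "r \<le> c" for r
    using e(2)[of r] B[of r] that by (cases "r < e") force+
  then show ?thesis by blast
qed

text \<open>The forcing term \<open>M\<^sup>k y\<^bsup>1-k\<^esup>\<close> is nonincreasing in \<open>y\<close>, so \<open>r\<^bsup>2a\<^esup> (y\<^sub>1 - y\<^sub>2)\<^sup>2\<close> obeys a
  linear differential inequality and vanishes with its value at \<open>0\<close>.\<close>

lemma riccati_solution_unique:
  fixes y1 y2 :: "real \<Rightarrow> real"
  assumes y: "riccati_solution k a M y1" "riccati_solution k a M y2" and "k \<ge> 1" "a > 0"
    and bdd: "eventually (\<lambda>r. y1 r \<le> L1) (at_right 0)" "eventually (\<lambda>r. y2 r \<le> L2) (at_right 0)"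
    and c: "0 < c" "c < 1"
  shows "y1 c = y2 c"
proof -
  obtain B1 where B1: "\<And>r. 0 < r \<Longrightarrow> r \<le> c \<Longrightarrow> y1 r \<le> B1"
    using riccati_solution_bounded[OF y(1) bdd(1) c(2)] by auto
  obtain B2 where B2: "\<And>r. 0 < r \<Longrightarrow> r \<le> c \<Longrightarrow> y2 r \<le> B2"
    using riccati_solution_bounded[OF y(2) bdd(2) c(2)] by auto
  define B where "B = B1 + B2"
  have pos: "y1 s > 0" "y2 s > 0" if "0 < s" "s < 1" for s
    using y that by (auto simp: riccati_solution_def)
  define d where "d s = y1 s - y2 s" for s
  \<comment> \<open>The power cancels the term \<open>- a * d\<close> in the equation for d; the
    exponential absorbs the quadratic term, because B bounds \<open>y1 + y2\<close> on the interval
    up to c.\<close>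
  define F where "F s = s powr (2 * a) * (d s)\<^sup>2 * exp (- 2 * B * s)" for s
  define f where "f s = M powr k * (y1 s powr (1 - k) - y2 s powr (1 - k))" for s
  have D: "(F has_real_derivative
      2 * s powr (2 * a - 1) * exp (- 2 * B * s) *
        (d s * f s + (s\<^sup>2 * (y1 s + y2 s) - B * s) * (d s)\<^sup>2)) (at s)"
    if s: "0 < s" "s < 1" for s
  proof -
    let ?D = "(f s - a * d s + s\<^sup>2 * (y1 s + y2 s) * d s) / s"
    have "(d has_real_derivative
       (M powr k * y1 s powr (1 - k) - a * y1 s + s\<^sup>2 * (y1 s)\<^sup>2) / s -
       (M powr k * y2 s powr (1 - k) - a * y2 s + s\<^sup>2 * (y2 s)\<^sup>2) / s) (at s)"
      unfolding d_def using y s by (intro DERIV_diff) (auto simp: riccati_solution_def)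
    moreover have "(M powr k * y1 s powr (1 - k) - a * y1 s + s\<^sup>2 * (y1 s)\<^sup>2) / s -
       (M powr k * y2 s powr (1 - k) - a * y2 s + s\<^sup>2 * (y2 s)\<^sup>2) / s = ?D"
      using s by (simp add: f_def d_def divide_simps) algebra
    ultimately have d: "(d has_real_derivative ?D) (at s)" by simp
    have "(F has_real_derivative
       (2 * a * s powr (2 * a - 1) * (d s)\<^sup>2 + 2 * d s * ?D * s powr (2 * a)) * exp (- 2 * B * s) +
       - 2 * B * exp (- 2 * B * s) * (s powr (2 * a) * (d s)\<^sup>2)) (at s)"
      unfolding F_def by (rule derivative_eq_intros d refl | use s in simp)+
    moreover have 1: "s powr (2 * a) = s powr (2 * a - 1) * s"
      using s powr_add[of s "2*a-1" 1] by simp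
    moreover have 2: "(2 * a * A * q\<^sup>2 + 2 * q * ((h - a * q + s\<^sup>2 * Y * q) / s) * (A * s)) * E +
        - 2 * B * E * (A * s * q\<^sup>2) = 2 * A * E * (q * h + (s\<^sup>2 * Y - B * s) * q\<^sup>2)" for A E q h Y
      using s by (simp add: field_simps power2_eq_square)
    ultimately show ?thesis unfolding 1 2 by blast
  qed
  have dec: "F t \<le> F s" if st: "0 < s" "s \<le> t" "t \<le> c" for s t
  proof (rule DERIV_nonpos_imp_nonincreasing[of s t F])
    show "s \<le> t" using st by simp
    fix x assume "s \<le> x" "x \<le> t"
    then have x: "0 < x" "x < 1" "x \<le> c" using st c by auto
    have "d x * f x \<le> 0"
    proof (cases "y1 x \<le> y2 x")
      case True
      then have "y2 x powr (1 - k) \<le> y1 x powr (1 - k)"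
        using pos[OF x(1,2)] assms by (intro powr_mono2') auto
      then show ?thesis using True by (auto simp: d_def f_def intro!: mult_nonpos_nonneg)
    next
      case False
      then have "y1 x powr (1 - k) \<le> y2 x powr (1 - k)"
        using pos[OF x(1,2)] assms by (intro powr_mono2') auto
      then show ?thesis using False by (auto simp: d_def f_def intro!: mult_nonneg_nonpos)
    qed
    moreover have "(x\<^sup>2 * (y1 x + y2 x) - B * x) * (d x)\<^sup>2 \<le> 0"
    proof -
      have "x * (y1 x + y2 x) \<le> 1 * (y1 x + y2 x)"
        using pos[OF x(1,2)] x by (intro mult_right_mono) auto
      also have "\<dots> \<le> B" using B1[of x] B2[of x] x by (simp add: B_def)
      finally have "x * (x * (y1 x + y2 x) - B) \<le> 0" using x by (intro mult_nonneg_nonpos) auto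
      then show ?thesis by (intro mult_nonpos_nonneg) (auto simp: algebra_simps power2_eq_square)
    qed
    ultimately have "2 * x powr (2 * a - 1) * exp (- 2 * B * x) *
        (d x * f x + (x\<^sup>2 * (y1 x + y2 x) - B * x) * (d x)\<^sup>2) \<le> 0"
      by (intro mult_nonneg_nonpos) auto
    then show "\<exists>y. (F has_real_derivative y) (at x) \<and> y \<le> 0" using D[OF x(1,2)] by blast
  qed
  have "0 \<le> B" using B1[of c] B2[of c] pos[of c] c by (simp add: B_def)
  have "F c \<le> s powr (2 * a) * B\<^sup>2" if s: "0 < s" "s < c" for s
  proof -
    have "\<bar>d s\<bar> \<le> B" using B1[of s] B2[of s] pos[of s] s c by (simp add: d_def B_def)
    then have "(d s)\<^sup>2 \<le> B\<^sup>2" using power_mono[of "\<bar>d s\<bar>" B 2] by simp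
    then have "s powr (2 * a) * (d s)\<^sup>2 * exp (- 2 * B * s) \<le> s powr (2 * a) * B\<^sup>2 * 1"
      using s \<open>0 \<le> B\<close> by (intro mult_mono) auto
    then have "F s \<le> s powr (2 * a) * B\<^sup>2" by (simp only: F_def mult_1_right)
    then show ?thesis using dec[of s c] s by linarith
  qed
  then have "eventually (\<lambda>s. F c \<le> s powr (2 * a) * B\<^sup>2) (at_right 0)"
    using c by (auto simp: eventually_at_right_field)
  moreover have "((\<lambda>s. s powr (2 * a) * B\<^sup>2) \<longlongrightarrow> 0 powr (2 * a) * B\<^sup>2) (at_right 0)"
    using assms by (intro tendsto_intros) (auto simp: eventually_at_filter)
  ultimately have "F c \<le> 0 powr (2 * a) * B\<^sup>2" by (intro tendsto_lowerbound) auto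
  then have "c powr (2 * a) * exp (- 2 * B * c) * (d c)\<^sup>2 \<le> 0"
    by (simp add: F_def mult.commute mult.left_commute)
  moreover have "c powr (2 * a) * exp (- 2 * B * c) > 0" using c by simp
  ultimately have "(d c)\<^sup>2 \<le> 0" by (metis linorder_not_le mult_pos_pos)
  then show ?thesis by (simp add: d_def)
qed

text \<open>This is the effect on the slope of replacing u by the function
  \<open>u (\<theta> * r)\<close>.\<close>

lemma riccati_solution_rescale:
  assumes y: "riccati_solution k a M y" and "0 < \<theta>" "\<theta> \<le> 1"
  shows "riccati_solution k a (\<theta>\<^sup>2 * M) (\<lambda>r. \<theta>\<^sup>2 * y (\<theta> * r))"
  unfolding riccati_solution_def
proof (intro ballI conjI)
  fix r :: real assume "r \<in> {0<..<1}"
  then have r: "0 < r" "0 < \<theta> * r" "\<theta> * r < 1"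
    using assms mult_less_le_imp_less[of r 1 \<theta> 1] by (auto simp: mult.commute)
  have pos: "y (\<theta> * r) > 0" using y r by (auto simp: riccati_solution_def)
  then show "0 < \<theta>\<^sup>2 * y (\<theta> * r)" using assms by simp
  let ?D = "(M powr k * y (\<theta> * r) powr (1 - k) - a * y (\<theta> * r) + (\<theta> * r)\<^sup>2 * (y (\<theta> * r))\<^sup>2) / (\<theta> * r)"
  have D: "(y has_real_derivative ?D) (at (\<theta> * r))"
    using y r by (auto simp: riccati_solution_def)
  have "((\<lambda>r. \<theta>\<^sup>2 * y (\<theta> * r)) has_real_derivative \<theta>\<^sup>2 * (?D * \<theta>)) (at r)"
    by (intro DERIV_cmult DERIV_chain2[where f = y and g = "\<lambda>r. \<theta> * r"] D) (auto intro!: derivative_eq_intros)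
  moreover have 1: "(\<theta>\<^sup>2 * M) powr k * (\<theta>\<^sup>2 * y (\<theta> * r)) powr (1 - k) =
      \<theta>\<^sup>2 * (M powr k * y (\<theta> * r) powr (1 - k))"
    using assms pos by (simp add: powr_mult powr_diff)
  moreover have 2: "\<theta>\<^sup>2 * ((X - a * Y + (\<theta> * r)\<^sup>2 * Y\<^sup>2) / (\<theta> * r) * \<theta>) =
      (\<theta>\<^sup>2 * X - a * (\<theta>\<^sup>2 * Y) + r\<^sup>2 * (\<theta>\<^sup>2 * Y)\<^sup>2) / r" for X Y
    using assms r by (simp add: field_simps power2_eq_square)
  ultimately show "((\<lambda>r. \<theta>\<^sup>2 * y (\<theta> * r)) has_real_derivative
        ((\<theta>\<^sup>2 * M) powr k * (\<theta>\<^sup>2 * y (\<theta> * r)) powr (1 - k) - a * (\<theta>\<^sup>2 * y (\<theta> * r)) +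
          r\<^sup>2 * (\<theta>\<^sup>2 * y (\<theta> * r))\<^sup>2) / r) (at r)"
    unfolding 1 2 by blast
qed

text \<open>If M2 were larger, scaling by some \<theta> below 1 would turn y2 into a solution with
  rate M1, equal to y1 by uniqueness. The rescaled function is continuous at 1, where y1 blows
  up.\<close>

lemma riccati_rate_le_of_blowup:
  assumes y1: "riccati_solution k a M1 y1" "filterlim y1 at_top (at_left 1)"
      "eventually (\<lambda>r. y1 r \<le> L1) (at_right 0)"
    and y2: "riccati_solution k a M2 y2" "eventually (\<lambda>r. y2 r \<le> L2) (at_right 0)"
    and "k \<ge> 1" "a > 0" "0 < M1"
  shows "M2 \<le> M1"
proof (rule ccontr)
  assume "\<not> ?thesis"
  then have M: "M1 < M2" by simp
  define \<theta> where "\<theta> = sqrt (M1 / M2)"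
  have \<theta>: "0 < \<theta>" "\<theta> < 1" "\<theta>\<^sup>2 * M2 = M1" using M assms by (auto simp: \<theta>_def)
  define Y where "Y r = \<theta>\<^sup>2 * y2 (\<theta> * r)" for r
  have Y: "riccati_solution k a M1 Y"
    using riccati_solution_rescale[OF y2(1), of \<theta>] \<theta> by (simp add: Y_def[abs_def])
  obtain e where e: "e > 0" "\<And>s. 0 < s \<Longrightarrow> s < e \<Longrightarrow> y2 s \<le> L2"
    using y2(2) by (auto simp: eventually_at_right_field)
  have "Y s \<le> \<theta>\<^sup>2 * L2" if "0 < s" "s < e" for s
  proof -
    have "\<theta> * s < 1 * e" using that \<theta> by (intro mult_strict_mono) auto
    then show ?thesis using e(2)[of "\<theta> * s"] that \<theta> by (simp add: Y_def)
  qed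
  then have bddY: "eventually (\<lambda>r. Y r \<le> \<theta>\<^sup>2 * L2) (at_right 0)"
    using e(1) by (auto simp: eventually_at_right_field)
  have eq: "Y r = y1 r" if "0 < r" "r < 1" for r
    using riccati_solution_unique[OF Y y1(1) _ _ bddY y1(3) that] assms by simp
  have "isCont (\<lambda>r. y2 (\<theta> * r)) 1"
    using riccati_solution_isCont[OF y2(1) \<theta>(1,2)]
    by (intro isCont_o2[where g = y2 and f = "\<lambda>r. \<theta> * r"]) auto
  then have "isCont (\<lambda>r. \<theta>\<^sup>2 * y2 (\<theta> * r)) 1" by (rule continuous_mult_left)
  then have "(Y \<longlongrightarrow> Y 1) (at_left 1)"
    by (auto simp: Y_def[abs_def] isCont_def intro: tendsto_within_subset)
  moreover have "eventually (\<lambda>r. Y r = y1 r) (at_left 1)"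
    using eq by (auto simp: eventually_at_left_field intro: exI[of _ 0])
  ultimately have "(y1 \<longlongrightarrow> Y 1) (at_left 1)" by (rule Lim_transform_eventually)
  then show False
    using not_tendsto_and_filterlim_at_infinity[of "at_left 1" y1] y1(2)
      filterlim_at_top_imp_at_infinity by auto
qed

lemma riccati_rate_unique:
  assumes "riccati_solution k a M1 y1" "filterlim y1 at_top (at_left 1)"
      "eventually (\<lambda>r. y1 r \<le> L1) (at_right 0)"
    and "riccati_solution k a M2 y2" "filterlim y2 at_top (at_left 1)"
      "eventually (\<lambda>r. y2 r \<le> L2) (at_right 0)"
    and "k \<ge> 1" "a > 0" "0 < M1" "0 < M2"
  shows "M1 = M2"
  using riccati_rate_le_of_blowup[of k a M1 y1 L1 M2 y2 L2]
    riccati_rate_le_of_blowup[of k a M2 y2 L2 M1 y1 L1] assms by force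

section \<open>From eigenpairs to the Riccati equation\<close>

lemma real_binom_pos:
  assumes "1 \<le> k" "k \<le> n"
  shows "real_binom (n - 1) (k - 1) > 0"
  using assms by (simp add: real_binom_def Gamma_real_pos)

definition radial_rate :: "real \<Rightarrow> real \<Rightarrow> real \<Rightarrow> real" where
  "radial_rate k n l = l / real_binom (n - 1) (k - 1) powr (1 / k)"

definition radial_slope :: "(real \<Rightarrow> real) \<Rightarrow> real \<Rightarrow> real" where
  "radial_slope u r = deriv u r / (- r * u r)"

lemma C2_onD:
  assumes "C2_on {0<..<1} u" "0 < r" "r < 1"
  shows "(u has_real_derivative deriv u r) (at r)"
    "(deriv u has_real_derivative deriv (deriv u) r) (at r)"
proof -
  have "f differentiable at r" if "f differentiable_on {0<..<1}" for f :: "real \<Rightarrow> real"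
    using that assms at_within_open[of r "{0<..<1}"]
    unfolding differentiable_on_def by (metis greaterThanLessThan_iff open_greaterThanLessThan)
  then show "(u has_real_derivative deriv u r) (at r)"
    "(deriv u has_real_derivative deriv (deriv u) r) (at r)"
    using assms by (auto simp: C2_on_def DERIV_deriv_iff_real_differentiable)
qed

text \<open>The hypotheses are pointwise conditions without boundary values, because the lemma is
  applied to eigenfunctions and also to rescaled Volterra solutions that need not vanish at
  1.\<close>

lemma riccati_solution_radial_slope:
  assumes kn: "1 \<le> k" "k \<le> n" and "l > 0" and C2: "C2_on {0<..<1} u"
    and u: "\<And>r. 0 < r \<Longrightarrow> r < 1 \<Longrightarrow> u r < 0"
    and u': "\<And>r. 0 < r \<Longrightarrow> r < 1 \<Longrightarrow> deriv u r > 0"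
    and eq: "\<And>r. 0 < r \<Longrightarrow> r < 1 \<Longrightarrow> radial_hessian k n u r = rpow (- l * u r) k"
  shows "riccati_solution k (n / k) (radial_rate k n l) (radial_slope u)"
  unfolding riccati_solution_def
proof (intro ballI conjI)
  fix r :: real assume "r \<in> {0<..<1}"
  then have r: "0 < r" "r < 1" by auto
  define c where "c = real_binom (n - 1) (k - 1)"
  define v where "v = - u r"
  define Y where "Y = radial_slope u r"
  define w where "w = deriv (deriv u) r"
  have c: "c > 0" using real_binom_pos kn by (simp add: c_def)
  have v: "v > 0" using u r by (simp add: v_def)
  have d: "deriv u r = r * (Y * v)" using r v by (simp add: Y_def radial_slope_def v_def)
  show "0 < radial_slope u r" using u[OF r] u'[OF r] r by (simp add: radial_slope_def divide_pos_neg mult_pos_neg)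
  then have Y: "Y > 0" by (simp add: Y_def)
  have rate: "radial_rate k n l powr k = l powr k / c"
    using kn \<open>l > 0\<close> c by (simp add: radial_rate_def powr_divide powr_powr c_def)
  have "c * (Y * v) powr (k - 1) * (w + (n - k) / k * (Y * v)) = (l * v) powr k"
    using eq[OF r] r kn Y v d
    by (simp add: radial_hessian_def rpow_def c_def v_def w_def split: if_splits)
  \<comment> \<open>Multiplying by \<open>(Y * v) powr (1 - k)\<close> isolates the second
    derivative.\<close>
  moreover have "(Y * v) powr (k - 1) * (Y * v) powr (1 - k) = 1"
    using Y v by (simp add: powr_add[symmetric])
  ultimately have "c * (w + (n - k) / k * (Y * v)) = (l * v) powr k * (Y * v) powr (1 - k)"
    by (metis (no_types, opaque_lifting) mult.assoc mult.commute mult_1)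
  also have "\<dots> = l powr k * Y powr (1 - k) * v"
    using Y v \<open>l > 0\<close> by (simp add: powr_mult powr_diff)
  finally have w: "w = (l powr k / c * Y powr (1 - k) - (n / k - 1) * Y) * v"
    using c kn by (simp add: field_simps)
  have "(radial_slope u has_real_derivative
      (w * (- r * u r) - deriv u r * (- u r - r * deriv u r)) / ((- r * u r) * (- r * u r))) (at r)"
    unfolding radial_slope_def[abs_def] w_def using r u[OF r]
    by (auto intro!: derivative_eq_intros C2_onD[OF C2 r] simp: algebra_simps diff_divide_distrib add_divide_distrib)
  moreover have "(w * (- r * u r) - deriv u r * (- u r - r * deriv u r)) / ((- r * u r) * (- r * u r))
      = (w * (r * v) - r * (Y * v) * (v - r * (r * (Y * v)))) / ((r * v) * (r * v))"
    unfolding d by (simp add: v_def)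
  moreover have "\<dots> = (l powr k / c * Y powr (1 - k) - n / k * Y + r\<^sup>2 * Y\<^sup>2) / r"
    unfolding w using r v by (simp add: field_simps power2_eq_square)
  ultimately show "(radial_slope u has_real_derivative
      (radial_rate k n l powr k * radial_slope u r powr (1 - k) - n / k * radial_slope u r
       + r\<^sup>2 * (radial_slope u r)\<^sup>2) / r) (at r)"
    unfolding rate Y_def by simp
qed

section \<open>Signs and boundary behaviour of eigenfunctions\<close>

lemma tendsto_left_ge:
  fixes u :: "real \<Rightarrow> real"
  assumes "(u \<longlongrightarrow> L) (at_left b)" "a < b" "\<And>s. a < s \<Longrightarrow> s < b \<Longrightarrow> c \<le> u s"
  shows "c \<le> L"
proof (rule tendsto_lowerbound[OF assms(1)])
  show "eventually (\<lambda>x. c \<le> u x) (at_left b)"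
    using assms by (auto simp: eventually_at_left_field)
qed simp

text \<open>The derivative of the flux is \<open>r powr (a - 1)\<close> times the expression that is
  nonnegative by convexity.\<close>

lemma alpha_convex_flux_mono:
  assumes u: "alpha_convex a u" and st: "0 < s" "s \<le> t" "t < 1"
  shows "s powr (a - 1) * deriv u s \<le> t powr (a - 1) * deriv u t"
proof (rule DERIV_nonneg_imp_nondecreasing[OF st(2), of "\<lambda>r. r powr (a - 1) * deriv u r"])
  fix x assume "s \<le> x" "x \<le> t"
  then have x: "0 < x" "x < 1" using st by auto
  have "((\<lambda>r. r powr (a - 1) * deriv u r) has_real_derivative
     (a - 1) * x powr (a - 1 - 1) * deriv u x + deriv (deriv u) x * x powr (a - 1)) (at x)"
    using x u by (auto intro!: derivative_eq_intros C2_onD[of u x] simp: alpha_convex_def)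
  moreover have "(a - 1) * x powr (a - 1 - 1) * deriv u x + deriv (deriv u) x * x powr (a - 1) =
      x powr (a - 1) * (deriv (deriv u) x + (a - 1) * (deriv u x / x))"
  proof -
    have "x powr (a - 1 - 1) = x powr (a - 1) / x" using x by (simp only: powr_diff powr_one)
    then show ?thesis by (simp only:) (simp add: algebra_simps)
  qed
  moreover have "x powr (a - 1) * (deriv (deriv u) x + (a - 1) * (deriv u x / x)) \<ge> 0"
    using u x by (auto simp: alpha_convex_def)
  ultimately show "\<exists>y. ((\<lambda>r. r powr (a - 1) * deriv u r) has_real_derivative y) (at x) \<and> 0 \<le> y"
    by auto
qed

text \<open>A zero of the derivative at r propagates to all smaller radii by monotonicity of the
  flux, so u is constantly -1 there. Then the Hessian side vanishes while the right side is a power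
  of the positive eigenvalue.\<close>

lemma radial_eigenpair_deriv_pos:
  assumes kn: "1 \<le> k" "k \<le> n" and u: "radial_eigenpair k n u l" and r: "0 < r" "r < 1"
  shows "deriv u r > 0"
proof (rule ccontr)
  assume not_pos: "\<not> deriv u r > 0"
  have ac: "alpha_convex (n / k) u" and C2: "C2_on {0<..<1} u" and l: "l > 0"
    using u by (auto simp: radial_eigenpair_def alpha_convex_def)
  have nonneg: "deriv u s \<ge> 0" if "0 < s" "s < 1" for s
    using ac that by (auto simp: alpha_convex_def)
  have "deriv u r = 0" using not_pos nonneg[OF r] by linarith
  have zero: "deriv u s = 0" if s: "0 < s" "s \<le> r" for s
  proof -
    have "s powr (n / k - 1) * deriv u s \<le> 0"
      using alpha_convex_flux_mono[OF ac s r(2)] \<open>deriv u r = 0\<close> by simp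
    then show ?thesis using nonneg[of s] s r by (simp add: mult_le_0_iff)
  qed
  have const: "u s = u r" if s: "0 < s" "s \<le> r" for s
  proof (cases "s = r")
    case False
    then have sr: "s < r" using s by simp
    show ?thesis
    proof (rule DERIV_isconst_end[of s r u, symmetric])
      show "s < r" by (fact sr)
      have "isCont u x" if "x \<in> {s..r}" for x
        using C2_onD(1)[OF C2, of x] s r that by (auto intro: DERIV_isCont)
      then show "continuous_on {s..r} u" by (rule continuous_at_imp_continuous_on[OF ballI])
      show "(u has_real_derivative 0) (at x)" if "s < x" "x < r" for x
        using C2_onD(1)[OF C2, of x] zero[of x] s r that by auto
    qed
  qed simp
  have "((\<lambda>_::real. u r) \<longlongrightarrow> -1) (at_right 0)"
  proof (rule Lim_transform_eventually[of u])
    show "(u \<longlongrightarrow> -1) (at_right 0)" using u by (simp add: radial_eigenpair_def)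
    show "eventually (\<lambda>s. u s = u r) (at_right 0)"
      using eventually_at_right_real[OF r(1)] by eventually_elim (rule const, auto)
  qed
  then have ur: "u r = -1" by (simp add: tendsto_const_iff)
  \<comment> \<open>\<open>r / 2\<close> lies inside the interval on which the first derivative
    vanishes.\<close>
  have "deriv (deriv u) (r / 2) = 0"
  proof -
    have "(deriv u has_real_derivative 0) (at (r / 2))"
    proof (rule has_field_derivative_transform_within_open[of "\<lambda>_. 0" 0 "r / 2" "{0<..<r}" "deriv u"])
      show "r / 2 \<in> {0<..<r}" using r by auto
    qed (use zero in auto)
    then show ?thesis by (rule DERIV_imp_deriv)
  qed
  \<comment> \<open>It is the last factor that vanishes; this covers \<open>k = 1\<close>, where the
    \<open>rpow\<close> factor is 1.\<close>
  then have "radial_hessian k n u (r / 2) = 0"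
    using zero[of "r / 2"] r by (simp add: radial_hessian_def)
  moreover have "radial_hessian k n u (r / 2) = rpow (- l * u (r / 2)) k"
    using u r by (simp add: radial_eigenpair_def)
  moreover have "u (r / 2) = -1" using const[of "r / 2"] ur r by simp
  ultimately show False using l kn by (simp add: rpow_def)
qed

lemma radial_eigenpair_neg:
  assumes kn: "1 \<le> k" "k \<le> n" and u: "radial_eigenpair k n u l" and r: "0 < r" "r < 1"
  shows "u r < 0"
proof -
  have C2: "C2_on {0<..<1} u" using u by (auto simp: radial_eigenpair_def alpha_convex_def)
  have less: "u s < u t" if "0 < s" "s < t" "t < 1" for s t
  proof (rule DERIV_pos_imp_increasing[OF that(2)])
    fix x assume "s \<le> x" "x \<le> t"
    then show "\<exists>y. (u has_real_derivative y) (at x) \<and> 0 < y"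
      using C2_onD(1)[OF C2, of x] radial_eigenpair_deriv_pos[OF kn u, of x] that by auto
  qed
  \<comment> \<open>The limit at 1 yields only \<open>u m \<le> 0\<close>; strict monotonicity from
    r to m makes the inequality strict.\<close>
  define m where "m = (r + 1) / 2"
  have m: "r < m" "m < 1" using r by (auto simp: m_def)
  have "u m \<le> 0"
  proof (rule tendsto_left_ge[of u 0 1 m])
    show "(u \<longlongrightarrow> 0) (at_left 1)" using u by (simp add: radial_eigenpair_def)
    show "u m \<le> u s" if "m < s" "s < 1" for s using less[of m s] that m r by simp
  qed (use m in auto)
  then show ?thesis using less[of r m] m r by simp
qed

lemma radial_eigenpair_riccati:
  assumes kn: "1 \<le> k" "k \<le> n" and u: "radial_eigenpair k n u l"
  shows "riccati_solution k (n / k) (radial_rate k n l) (radial_slope u)"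
proof (rule riccati_solution_radial_slope[OF kn])
  show "l > 0" "C2_on {0<..<1} u" using u by (auto simp: radial_eigenpair_def alpha_convex_def)
qed (use u kn in \<open>auto simp: radial_eigenpair_def intro: radial_eigenpair_neg[OF kn u]
      radial_eigenpair_deriv_pos[OF kn u]\<close>)

text \<open>The limsup condition bounds the quotient of the derivative by r, and -u is close to 1
  near 0. This selects the solution to which the uniqueness result applies.\<close>

lemma radial_slope_bounded:
  assumes kn: "1 \<le> k" "k \<le> n" and u: "radial_eigenpair k n u l"
  shows "\<exists>L. eventually (\<lambda>r. radial_slope u r \<le> L) (at_right 0)"
proof -
  have "Limsup (at_right 0) (\<lambda>r. ereal (deriv u r / r)) < \<infinity>"
    using u by (auto simp: radial_eigenpair_def alpha_convex_def)
  then obtain C where C: "Limsup (at_right 0) (\<lambda>r. ereal (deriv u r / r)) < ereal C"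
    by (metis less_PInf_Ex_of_nat ereal_dense2 less_ereal.simps(4))
  have "eventually (\<lambda>r. ereal (deriv u r / r) < ereal C) (at_right 0)"
    using C by (rule Limsup_lessD)
  moreover have "eventually (\<lambda>r. u r < - 1 / 2) (at_right 0)"
    using u by (intro order_tendstoD[where y = "-1"]) (auto simp: radial_eigenpair_def)
  moreover have "eventually (\<lambda>r. r \<in> {0<..<1}) (at_right (0::real))"
    by (rule eventually_at_right_real) simp
  ultimately have "eventually (\<lambda>r. radial_slope u r \<le> 2 * C) (at_right 0)"
  proof eventually_elim
    case (elim r)
    have "deriv u r / r > 0" using radial_eigenpair_deriv_pos[OF kn u, of r] elim by simp
    moreover have "radial_slope u r = (deriv u r / r) / (- u r)" by (simp add: radial_slope_def)
    moreover have "(deriv u r / r) / (- u r) \<le> C / (1 / 2)"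
      using elim calculation by (intro frac_le) auto
    ultimately show ?case by simp
  qed
  then show ?thesis by blast
qed

text \<open>Monotonicity of the flux keeps the derivative above a positive constant on the right
  half of the interval, while -u tends to 0 from above.\<close>

lemma radial_slope_at_top:
  assumes kn: "1 \<le> k" "k \<le> n" and u: "radial_eigenpair k n u l"
  shows "filterlim (radial_slope u) at_top (at_left 1)"
proof -
  have ac: "alpha_convex (n / k) u" using u by (simp add: radial_eigenpair_def)
  define C where "C = (1 / 2) powr (n / k - 1) * deriv u (1 / 2)"
  have C: "C > 0" using radial_eigenpair_deriv_pos[OF kn u, of "1/2"] by (simp add: C_def)
  have ev: "eventually (\<lambda>r. r \<in> {1/2<..<1}) (at_left (1::real))"
    by (rule eventually_at_left_real) simp
  have "((\<lambda>r. - u r) \<longlongrightarrow> - 0) (at_left 1)"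
    using u by (intro tendsto_minus) (simp add: radial_eigenpair_def)
  moreover have "eventually (\<lambda>r. - u r > 0) (at_left 1)"
    using ev by eventually_elim (auto intro: radial_eigenpair_neg[OF kn u])
  ultimately have "filterlim (\<lambda>r. C / (- u r)) at_top (at_left 1)"
    using C by (intro LIM_at_top_divide[where a = C]) auto
  moreover have "eventually (\<lambda>r. C / (- u r) \<le> radial_slope u r) (at_left 1)"
    using ev
  proof eventually_elim
    case (elim r)
    then have r: "0 < r" "r < 1" "1 / 2 \<le> r" by auto
    have d: "deriv u r > 0" using radial_eigenpair_deriv_pos[OF kn u r(1,2)] .
    have "C \<le> r powr (n / k - 1) * deriv u r"
      unfolding C_def using r by (intro alpha_convex_flux_mono[OF ac]) auto
    also have "\<dots> \<le> 1 * deriv u r"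
      using kn r d by (intro mult_right_mono powr_le1) auto
    also have "\<dots> \<le> deriv u r / r" using r d by (simp add: field_simps)
    finally have "C / (- u r) \<le> (deriv u r / r) / (- u r)"
      using radial_eigenpair_neg[OF kn u r(1,2)] by (intro divide_right_mono) auto
    then show ?case by (simp add: radial_slope_def)
  qed
  ultimately show ?thesis by (rule filterlim_at_top_mono)
qed

lemma radial_eigenpair_rate_bounds:
  assumes kn: "1 \<le> k" "k \<le> n" and u: "radial_eigenpair k n u l"
  shows "radial_rate k n l \<le> (n / k) powr (1 / k) * critical_rate (n / k)"
    and "\<eta> > 0 \<Longrightarrow> critical_rate (n / k - (1 + \<eta>) powr (- k)) \<le> (1 + \<eta>) * radial_rate k n l"
proof -
  have l: "radial_rate k n l > 0"
    using u real_binom_pos[OF kn] by (simp add: radial_rate_def radial_eigenpair_def)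
  note * = radial_eigenpair_riccati[OF kn u]
  show "radial_rate k n l \<le> (n / k) powr (1 / k) * critical_rate (n / k)"
    using riccati_rate_le[OF *] kn l by simp
  obtain L where "eventually (\<lambda>r. radial_slope u r \<le> L) (at_right 0)"
    using radial_slope_bounded[OF kn u] by blast
  then show "critical_rate (n / k - (1 + \<eta>) powr (- k)) \<le> (1 + \<eta>) * radial_rate k n l" if "\<eta> > 0"
    using riccati_rate_ge[OF * _ _ l that radial_slope_at_top[OF kn u] _ refl] kn by simp
qed

lemma radial_eigenpair_unique:
  assumes kn: "1 \<le> k" "k \<le> n" and u: "radial_eigenpair k n u1 l1" "radial_eigenpair k n u2 l2"
  shows "l1 = l2"
proof -
  obtain L1 where L1: "eventually (\<lambda>r. radial_slope u1 r \<le> L1) (at_right 0)"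
    using radial_slope_bounded[OF kn u(1)] by blast
  obtain L2 where L2: "eventually (\<lambda>r. radial_slope u2 r \<le> L2) (at_right 0)"
    using radial_slope_bounded[OF kn u(2)] by blast
  have "radial_rate k n l1 = radial_rate k n l2"
    using u kn real_binom_pos[OF kn]
    by (intro riccati_rate_unique[OF radial_eigenpair_riccati[OF kn u(1)] radial_slope_at_top[OF kn u(1)] L1
         radial_eigenpair_riccati[OF kn u(2)] radial_slope_at_top[OF kn u(2)] L2])
       (auto simp: radial_rate_def radial_eigenpair_def)
  then show ?thesis using real_binom_pos[OF kn] by (simp add: radial_rate_def)
qed

section \<open>A Volterra equation for the eigenfunction\<close>

lemma continuous_on_nonneg_if_bounded:
  fixes f :: "real \<Rightarrow> 'a :: topological_space"
  assumes "\<And>b. b > 0 \<Longrightarrow> continuous_on {0..b} f"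
  shows "continuous_on {0..} f"
  unfolding continuous_on_def
proof
  fix x :: real assume x: "x \<in> {0..}"
  have "(f \<longlongrightarrow> f x) (at x within {0..x + 1})"
    using assms[of "x + 1"] x by (auto simp: continuous_on_def)
  moreover have "at x within {0..} = at x within {0..x + 1}"
    by (rule at_within_nhd[of x "{..<x + 1}"]) auto
  ultimately show "(f \<longlongrightarrow> f x) (at x within {0..})" by simp
qed

lemma continuous_on_integral_nonneg:
  fixes h :: "real \<Rightarrow> real"
  assumes "continuous_on {0..} h"
  shows "continuous_on {0..} (\<lambda>x. integral {0..x} h)"
proof (rule continuous_on_nonneg_if_bounded)
  fix b :: real
  have "continuous_on {0..b} h" using assms by (rule continuous_on_subset) auto
  then show "continuous_on {0..b} (\<lambda>x. integral {0..x} h)"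
    by (intro indefinite_integral_continuous_1 integrable_continuous_real)
qed

lemma DERIV_integral_nonneg:
  fixes h :: "real \<Rightarrow> real"
  assumes "continuous_on {0..} h" "x > 0"
  shows "((\<lambda>x. integral {0..x} h) has_real_derivative h x) (at x)"
proof -
  have "continuous_on {0..x + 1} h" using assms(1) by (rule continuous_on_subset) auto
  then have "((\<lambda>x. integral {0..x} h) has_real_derivative h x) (at x within {0..x + 1})"
    using assms by (intro integral_has_real_derivative) auto
  moreover have "at x within {0..x + 1} = at x"
    using assms by (intro at_within_interior) auto
  ultimately show ?thesis by simp
qed

text \<open>Convexity of the power between x and 1, the pointwise inequality behind the Minkowski
  estimate below.\<close>

lemma powr_convex_comb_1:
  assumes "k \<ge> 1" "0 \<le> p" "p \<le> 1" "0 \<le> (x::real)"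
  shows "(p * x + (1 - p)) powr k \<le> p * x powr k + (1 - p)"
proof (cases "x = 0")
  case True
  have "(1 - p) powr k \<le> (1 - p) powr 1"
    using assms by (intro powr_mono') auto
  then show ?thesis using True assms by simp
next
  case False
  have "(\<lambda>x. x powr k) ((1 - p) *\<^sub>R 1 + p *\<^sub>R x) \<le> (1 - p) * (\<lambda>x. x powr k) 1 + p * (\<lambda>x. x powr k) x"
    using assms False by (intro convex_onD[OF powr_convex]) auto
  then show ?thesis by (simp add: algebra_simps)
qed

section \<open>The mean operator\<close>

definition unit_valued :: "(real \<Rightarrow> real) \<Rightarrow> bool" where
  "unit_valued w \<longleftrightarrow> continuous_on {0..} w \<and> (\<forall>t\<ge>0. 0 \<le> w t \<and> w t \<le> 1)"

text \<open>After the substitution \<open>s = x\<^sup>n\<close> this is the \<open>L\<^sup>k\<close>-mean of \<open>w\<close> over the ball of radius \<open>t\<close>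
  in dimension \<open>n\<close>.\<close>

definition radial_mean :: "real \<Rightarrow> real \<Rightarrow> (real \<Rightarrow> real) \<Rightarrow> real \<Rightarrow> real" where
  "radial_mean k n w t =
     (integral {0..t powr n} (\<lambda>s. w (s powr (1 / n)) powr k) / t powr n) powr (1 / k)"

context
  fixes k n :: real
  assumes k: "k \<ge> 1" and n: "n > 0"
begin

lemma continuous_on_radial_integrand:
  assumes "unit_valued w"
  shows "continuous_on {0..} (\<lambda>s. w (s powr (1 / n)) powr k)"
proof -
  have w: "continuous_on {0..} w" "\<And>t. 0 \<le> t \<Longrightarrow> 0 \<le> w t"
    using assms by (auto simp: unit_valued_def)
  have "continuous_on {0..} (\<lambda>s::real. s powr (1 / n))"
    using n by (intro continuous_on_powr' continuous_intros) auto
  from continuous_on_compose2[OF w(1) this] have "continuous_on {0..} (\<lambda>s. w (s powr (1 / n)))"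
    by (simp add: image_subset_iff)
  from continuous_on_powr'[OF this continuous_on_const] show ?thesis
    using w(2) k by simp
qed

lemma radial_integrand_integrable:
  "unit_valued w \<Longrightarrow> (\<lambda>s. w (s powr (1 / n)) powr k) integrable_on {0..x}"
  using continuous_on_subset[OF continuous_on_radial_integrand, of w "{0..x}"]
  by (simp add: integrable_continuous_real)

lemma radial_mean_powr:
  assumes "unit_valued w" "t > 0"
  shows "radial_mean k n w t powr k =
     integral {0..t powr n} (\<lambda>s. w (s powr (1 / n)) powr k) / t powr n"
proof -
  have "0 \<le> integral {0..t powr n} (\<lambda>s. w (s powr (1 / n)) powr k) / t powr n"
    by (intro divide_nonneg_nonneg integral_nonneg radial_integrand_integrable assms) auto
  then show ?thesis using k powr_one[of "integral {0..t powr n} (\<lambda>s. w (s powr (1 / n)) powr k) / t powr n"]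
    unfolding radial_mean_def powr_powr by (simp del: powr_one powr_one_gt_zero_iff)
qed

lemma radial_point_le:
  assumes "t > 0" "0 \<le> s" "s \<le> t powr n"
  shows "s powr (1 / n) \<le> t"
proof -
  have "s powr (1 / n) \<le> (t powr n) powr (1 / n)" using assms n by (intro powr_mono2) auto
  then show ?thesis using assms n by (simp add: powr_powr)
qed

lemma radial_mean_leI:
  assumes w: "unit_valued w" and "t > 0" "B \<ge> 0"
    and le: "integral {0..t powr n} (\<lambda>s. w (s powr (1 / n)) powr k) \<le> B powr k * t powr n"
  shows "radial_mean k n w t \<le> B"
proof -
  let ?H = "integral {0..t powr n} (\<lambda>s. w (s powr (1 / n)) powr k)"
  have "?H / t powr n \<le> B powr k" using le \<open>t > 0\<close> by (simp add: pos_divide_le_eq)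
  moreover have "0 \<le> ?H / t powr n"
    by (intro divide_nonneg_nonneg integral_nonneg radial_integrand_integrable w) auto
  ultimately have "(?H / t powr n) powr (1 / k) \<le> (B powr k) powr (1 / k)"
    using k by (intro powr_mono2) auto
  then show ?thesis using k \<open>B \<ge> 0\<close> by (simp add: radial_mean_def powr_powr)
qed

lemma radial_mean_le_1:
  assumes w: "unit_valued w" and t: "t > 0"
  shows "radial_mean k n w t \<le> 1"
proof (rule radial_mean_leI[OF w t])
  have "integral {0..t powr n} (\<lambda>s. w (s powr (1 / n)) powr k) \<le> integral {0..t powr n} (\<lambda>s. 1)"
    using w k by (intro integral_le radial_integrand_integrable powr_le1) (auto simp: unit_valued_def)
  then show "integral {0..t powr n} (\<lambda>s. w (s powr (1 / n)) powr k) \<le> 1 powr k * t powr n"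
    using t by simp
qed simp

lemma radial_mean_ge:
  assumes w: "unit_valued w" and t: "t > 0" and "b \<ge> 0" "\<And>s. 0 \<le> s \<Longrightarrow> s \<le> t \<Longrightarrow> b \<le> w s"
  shows "b \<le> radial_mean k n w t"
proof -
  have "integral {0..t powr n} (\<lambda>s. b powr k) \<le> integral {0..t powr n} (\<lambda>s. w (s powr (1 / n)) powr k)"
    using assms k
    by (intro integral_le integrable_const_ivl radial_integrand_integrable powr_mono2)
       (auto intro!: assms(4) radial_point_le)
  then have "b powr k \<le> radial_mean k n w t powr k"
    using t by (simp add: radial_mean_powr[OF w t] field_simps)
  then have "(b powr k) powr (1 / k) \<le> (radial_mean k n w t powr k) powr (1 / k)"
    using k by (intro powr_mono2[of "1 / k"]) auto
  moreover have "radial_mean k n w t \<ge> 0" by (simp add: radial_mean_def)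
  ultimately show ?thesis using k \<open>b \<ge> 0\<close> by (simp add: powr_powr)
qed

text \<open>Minkowski's inequality with a constant summand: the mean is \<open>1\<close>-Lipschitz for the supremum norm.\<close>

lemma radial_mean_le_add:
  assumes w: "unit_valued w1" "unit_valued w2" and t: "t > 0" and \<delta>: "\<delta> \<ge> 0"
    and le: "\<And>s. 0 \<le> s \<Longrightarrow> s \<le> t \<Longrightarrow> w1 s \<le> w2 s + \<delta>"
  shows "radial_mean k n w1 t \<le> radial_mean k n w2 t + \<delta>"
proof (rule field_le_epsilon)
  fix \<epsilon> :: real assume \<epsilon>: "\<epsilon> > 0"
  \<comment> \<open>Adding \<epsilon> allows division by A even if the mean of w2 is zero.\<close>
  define A where "A = radial_mean k n w2 t + \<epsilon>"
  have A: "A > 0" using \<epsilon> by (simp add: A_def radial_mean_def add_nonneg_pos)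
  \<comment> \<open>With this weight \<open>w2 + \<delta>\<close> equals \<open>A + \<delta>\<close>
    times the convex combination of \<open>w2 / A\<close> and 1.\<close>
  define p where "p = A / (A + \<delta>)"
  have p: "0 \<le> p" "p \<le> 1" "(A + \<delta>) * p = A" "(A + \<delta>) * (1 - p) = \<delta>"
    using A \<delta> by (auto simp: p_def field_simps)
  let ?x = "t powr n"
  let ?H1 = "integral {0..?x} (\<lambda>s. w1 (s powr (1 / n)) powr k)"
  let ?H2 = "integral {0..?x} (\<lambda>s. w2 (s powr (1 / n)) powr k)"
  have "?H2 = radial_mean k n w2 t powr k * ?x"
    using t by (simp add: radial_mean_powr[OF w(2) t])
  also have "\<dots> \<le> A powr k * ?x"
    using \<epsilon> k by (intro mult_right_mono powr_mono2) (auto simp: A_def radial_mean_def)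
  finally have H2: "?H2 / A powr k \<le> ?x" using A by (simp add: divide_le_eq mult.commute)
  have pt: "w1 (s powr (1 / n)) powr k \<le>
      (A + \<delta>) powr k * (p / A powr k * w2 (s powr (1 / n)) powr k + (1 - p))"
    if s: "s \<in> {0..?x}" for s
  proof -
    let ?s = "s powr (1 / n)"
    have *: "0 \<le> ?s" "?s \<le> t" using radial_point_le[of t s] t s by auto
    then have nn: "0 \<le> w1 ?s" "0 \<le> w2 ?s" using w by (auto simp: unit_valued_def)
    have "(A + \<delta>) * (p * (w2 ?s / A) + (1 - p)) = (A + \<delta>) * p * (w2 ?s / A) + (A + \<delta>) * (1 - p)"
      by (simp only: distrib_left mult.assoc)
    also have "\<dots> = w2 ?s + \<delta>" unfolding p using A by simp
    finally have "w1 ?s \<le> (A + \<delta>) * (p * (w2 ?s / A) + (1 - p))" using le[OF *] by simp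
    then have "w1 ?s powr k \<le> ((A + \<delta>) * (p * (w2 ?s / A) + (1 - p))) powr k"
      using nn k by (intro powr_mono2) auto
    also have "\<dots> = (A + \<delta>) powr k * (p * (w2 ?s / A) + (1 - p)) powr k"
      by (rule powr_mult)
    also have "\<dots> \<le> (A + \<delta>) powr k * (p * (w2 ?s / A) powr k + (1 - p))"
      using A nn p k by (intro mult_left_mono powr_convex_comb_1) auto
    finally show ?thesis using A nn by (simp add: powr_divide)
  qed
  have 1: "((\<lambda>s. p / A powr k * w2 (s powr (1 / n)) powr k) has_integral p / A powr k * ?H2) {0..?x}"
    by (intro has_integral_mult_right integrable_integral radial_integrand_integrable w)
  have 2: "((\<lambda>s. 1 - p) has_integral (1 - p) * ?x) {0..?x}"
    using has_integral_const_real[of "1 - p" 0 ?x] by (simp add: mult.commute)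
  have hi: "((\<lambda>s. (A + \<delta>) powr k * (p / A powr k * w2 (s powr (1 / n)) powr k + (1 - p)))
      has_integral (A + \<delta>) powr k * (p / A powr k * ?H2 + (1 - p) * ?x)) {0..?x}"
    by (rule has_integral_mult_right[OF has_integral_add[OF 1 2]])
  have "?H1 \<le> (A + \<delta>) powr k * (p / A powr k * ?H2 + (1 - p) * ?x)"
    by (rule has_integral_le[OF integrable_integral[OF radial_integrand_integrable[OF w(1)]] hi pt])
  also have "\<dots> \<le> (A + \<delta>) powr k * (p * ?x + (1 - p) * ?x)"
  proof (intro mult_left_mono add_right_mono powr_ge_zero)
    show "p / A powr k * ?H2 \<le> p * ?x"
      using mult_left_mono[OF H2 p(1)] by (simp only: times_divide_eq_left times_divide_eq_right)
  qed
  also have "\<dots> = (A + \<delta>) powr k * ?x" by (simp add: algebra_simps)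
  finally have "radial_mean k n w1 t \<le> A + \<delta>"
    using A \<delta> by (intro radial_mean_leI w t) auto
  then show "radial_mean k n w1 t \<le> radial_mean k n w2 t + \<delta> + \<epsilon>" by (simp add: A_def)
qed

text \<open>The k-th power of the mean is an average Q with \<open>t Q' = n (w powr k - Q)\<close>;
  positivity makes the root differentiable. Since the mean is proportional to the quotient of the
  derivative of u by r, this recovers the second-order equation from its integrated form.\<close>

lemma DERIV_radial_mean:
  assumes w: "unit_valued w" and t: "t > 0" and pos: "radial_mean k n w t > 0"
  shows "(radial_mean k n w has_real_derivative
     n / k * (w t powr k * radial_mean k n w t powr (1 - k) - radial_mean k n w t) / t) (at t)"
proof -
  define h where "h s = w (s powr (1 / n)) powr k" for s
  define Q where "Q t = integral {0..t powr n} h / t powr n" for t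
  have N: "radial_mean k n w t = Q t powr (1 / k)" for t
    by (simp add: radial_mean_def Q_def h_def[abs_def])
  have "Q t \<ge> 0" unfolding Q_def h_def[abs_def]
    by (intro divide_nonneg_nonneg integral_nonneg radial_integrand_integrable w) auto
  moreover have "Q t \<noteq> 0" using pos unfolding N by auto
  ultimately have Q: "Q t > 0" by simp
  have "((\<lambda>x. integral {0..x} h) has_real_derivative h (t powr n)) (at (t powr n))"
    using continuous_on_radial_integrand[OF w] t unfolding h_def[abs_def]
    by (intro DERIV_integral_nonneg) auto
  moreover have "((\<lambda>t. t powr n) has_real_derivative n * t powr (n - 1)) (at t)"
    using t by (rule has_real_derivative_powr)
  ultimately have D: "((\<lambda>t. integral {0..t powr n} h) has_real_derivative h (t powr n) * (n * t powr (n - 1))) (at t)"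
    by (rule DERIV_chain2)
  have ht: "h (t powr n) = w t powr k" using t n by (simp add: h_def powr_powr)
  have tn: "t powr (n - 1) = t powr n / t" using t by (simp add: powr_diff)
  have "(Q has_real_derivative
     (h (t powr n) * (n * t powr (n - 1)) * t powr n - integral {0..t powr n} h * (n * t powr (n - 1))) /
       (t powr n * t powr n)) (at t)"
    unfolding Q_def[abs_def] using t by (intro DERIV_divide D has_real_derivative_powr) auto
  moreover have "(h (t powr n) * (n * t powr (n - 1)) * t powr n - integral {0..t powr n} h * (n * t powr (n - 1))) /
       (t powr n * t powr n) = n * (w t powr k - Q t) / t"
    unfolding ht tn Q_def using t by (simp add: divide_simps) algebra
  ultimately have DQ: "(Q has_real_derivative n * (w t powr k - Q t) / t) (at t)" by simp
  have "((\<lambda>t. Q t powr (1 / k)) has_real_derivative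
      1 / k * Q t powr (1 / k - 1) * (n * (w t powr k - Q t) / t)) (at t)"
    using DERIV_fun_powr[OF DQ Q, of "1 / k"] by simp
  moreover have "(\<lambda>t. Q t powr (1 / k)) = radial_mean k n w" by (rule ext) (simp only: N)
  moreover have 1: "Q t powr (1 / k - 1) = radial_mean k n w t powr (1 - k)"
    unfolding N using k by (simp add: powr_powr diff_divide_distrib)
  moreover have 2: "radial_mean k n w t powr (1 - k) * Q t = radial_mean k n w t"
    unfolding 1[symmetric] unfolding N using Q powr_add[of "Q t" "1 / k - 1" 1] by simp
  moreover have "1 / k * X * (n * (Y - q) / t) = n / k * (Y * X - X * q) / t" for X Y q
    using k t by (simp add: field_simps)
  ultimately show ?thesis by metis
qed

text \<open>At 0 the mean takes the default value 0 coming from division by zero. The factor t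
  restores continuity there, because the mean is at most 1.\<close>

lemma continuous_on_radial_flux:
  assumes w: "unit_valued w"
  shows "continuous_on {0..} (\<lambda>t. C * (t * radial_mean k n w t))"
proof -
  have "continuous_on {0..} (\<lambda>t. t * radial_mean k n w t)"
    unfolding continuous_on_def
  proof
    fix t :: real assume "t \<in> {0..}"
    show "((\<lambda>t. t * radial_mean k n w t) \<longlongrightarrow> t * radial_mean k n w t) (at t within {0..})"
    proof (cases "t = 0")
      case True
      have "((\<lambda>t. t * radial_mean k n w t) \<longlongrightarrow> 0) (at_right 0)"
      proof (rule Lim_null_comparison[where g = "\<lambda>t. t"])
        show "eventually (\<lambda>t. norm (t * radial_mean k n w t) \<le> t) (at_right 0)"
          unfolding eventually_at_filter
        proof (intro always_eventually allI impI)
          fix t :: real assume "t \<noteq> 0" "t \<in> {0<..}"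
          then have "t > 0" by simp
          moreover have "radial_mean k n w t \<ge> 0" by (simp add: radial_mean_def)
          ultimately show "norm (t * radial_mean k n w t) \<le> t"
            using radial_mean_le_1[OF w \<open>t > 0\<close>] by (simp add: mult_left_le)
        qed
      qed (auto intro!: tendsto_eq_intros)
      then show ?thesis using True by (simp add: at_within_Ici_at_right)
    next
      case False
      then have t: "t > 0" using \<open>t \<in> {0..}\<close> by simp
      define h where "h s = w (s powr (1 / n)) powr k" for s
      have "isCont (\<lambda>x. integral {0..x} h) (t powr n)"
        using continuous_on_radial_integrand[OF w] t unfolding h_def[abs_def]
        by (intro DERIV_isCont[OF DERIV_integral_nonneg]) auto
      moreover have ct: "isCont (\<lambda>t. t powr n) t"
        using t by (intro DERIV_isCont[OF has_real_derivative_powr])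
      ultimately have "isCont (\<lambda>t. integral {0..t powr n} h) t"
        by (intro isCont_o2[OF ct])
      then have "((\<lambda>t. integral {0..t powr n} h / t powr n) \<longlongrightarrow> integral {0..t powr n} h / t powr n) (at t)"
        using ct t unfolding isCont_def by (intro tendsto_divide) auto
      then have "((\<lambda>t. radial_mean k n w t) \<longlongrightarrow> radial_mean k n w t) (at t)"
        unfolding radial_mean_def h_def
        using k by (intro tendsto_powr')
          (auto intro!: always_eventually divide_nonneg_nonneg integral_nonneg radial_integrand_integrable[OF w])
      then have "((\<lambda>t. t * radial_mean k n w t) \<longlongrightarrow> t * radial_mean k n w t) (at t)"
        by (intro tendsto_mult tendsto_ident_at)
      then show ?thesis by (rule tendsto_within_subset) simp
    qed
  qed
  then show ?thesis by (rule continuous_on_mult_left)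
qed

section \<open>Picard iteration\<close>

text \<open>Multiplied by \<open>r powr (n - 1)\<close>, the Hessian side is the derivative of
  \<open>c / k * r powr (n - k) * u' powr k\<close>, with c the binomial coefficient. For eigenvalue
  1, integrating and taking the k-th root gives \<open>u' = C * r * radial_mean k n (- u) r\<close>
  with \<open>C powr k * (n / k) * c = 1\<close>; the step integrates once more and truncates at
  0.\<close>

definition picard_step :: "real \<Rightarrow> (real \<Rightarrow> real) \<Rightarrow> real \<Rightarrow> real" where
  "picard_step C w r = max 0 (1 - integral {0..r} (\<lambda>t. C * (t * radial_mean k n w t)))"

lemma radial_flux_integrable:
  assumes "unit_valued w"
  shows "(\<lambda>t. C * (t * radial_mean k n w t)) integrable_on {0..r}"
  using continuous_on_subset[OF continuous_on_radial_flux[OF assms, of C], of "{0..r}"]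
  by (simp add: integrable_continuous_real)

lemma unit_valued_picard_step:
  assumes w: "unit_valued w" and "C \<ge> 0"
  shows "unit_valued (picard_step C w)"
proof -
  have "continuous_on {0..} (\<lambda>r. 1 - integral {0..r} (\<lambda>t. C * (t * radial_mean k n w t)))"
    by (intro continuous_on_diff continuous_on_const continuous_on_integral_nonneg
        continuous_on_radial_flux w)
  then have "continuous_on {0..} (picard_step C w)"
    unfolding picard_step_def[abs_def] by (intro continuous_on_max continuous_on_const)
  moreover have "0 \<le> integral {0..r} (\<lambda>t. C * (t * radial_mean k n w t))" for r
    using assms by (intro integral_nonneg radial_flux_integrable) (auto simp: radial_mean_def)
  ultimately show ?thesis by (auto simp: unit_valued_def picard_step_def)
qed

text \<open>The mean at t sees all of \<open>{0..t}\<close>, where monotonicity bounds the distance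
  by \<open>D t\<close>; both the mean and the truncation are 1-Lipschitz. A majorant that varies
  with the radius is what produces factorials under iteration.\<close>

lemma picard_step_diff:
  assumes w: "unit_valued w1" "unit_valued w2" and "C \<ge> 0" "r \<ge> 0"
    and le: "\<And>s. 0 \<le> s \<Longrightarrow> s \<le> r \<Longrightarrow> \<bar>w1 s - w2 s\<bar> \<le> D s"
    and D: "mono_on {0..r} D" and I: "((\<lambda>t. C * (t * D t)) has_integral I) {0..r}"
  shows "\<bar>picard_step C w1 r - picard_step C w2 r\<bar> \<le> I"
proof -
  let ?g = "\<lambda>w t. C * (t * radial_mean k n w t)"
  have "norm (integral {0..r} (\<lambda>t. ?g w1 t - ?g w2 t)) \<le> integral {0..r} (\<lambda>t. C * (t * D t))"
  proof (rule integral_norm_bound_integral)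
    show "(\<lambda>t. ?g w1 t - ?g w2 t) integrable_on {0..r}"
      by (intro integrable_diff radial_flux_integrable w)
    show "(\<lambda>t. C * (t * D t)) integrable_on {0..r}" using I by (rule has_integral_integrable)
    fix t assume "t \<in> {0..r}"
    then have t: "0 \<le> t" "t \<le> r" by auto
    show "norm (?g w1 t - ?g w2 t) \<le> C * (t * D t)"
    proof (cases "t = 0")
      case False
      then have "t > 0" using t by simp
      have le': "\<bar>w1 s - w2 s\<bar> \<le> D t" if "0 \<le> s" "s \<le> t" for s
        using le[of s] mono_onD[OF D, of s t] that t by force
      then have "0 \<le> D t" using t by force
      have "w1 s \<le> w2 s + D t" "w2 s \<le> w1 s + D t" if "0 \<le> s" "s \<le> t" for s
        using le'[OF that] by auto
      then have "\<bar>radial_mean k n w1 t - radial_mean k n w2 t\<bar> \<le> D t"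
        using radial_mean_le_add[OF w \<open>t > 0\<close> \<open>0 \<le> D t\<close>]
          radial_mean_le_add[OF w(2,1) \<open>t > 0\<close> \<open>0 \<le> D t\<close>] by (simp add: abs_le_iff)
      then have "C * t * \<bar>radial_mean k n w1 t - radial_mean k n w2 t\<bar> \<le> C * t * D t"
        using t \<open>C \<ge> 0\<close> by (intro mult_left_mono) auto
      moreover have "?g w1 t - ?g w2 t = C * t * (radial_mean k n w1 t - radial_mean k n w2 t)"
        by (simp add: algebra_simps)
      ultimately show ?thesis using t \<open>C \<ge> 0\<close> by (simp add: abs_mult mult.assoc)
    qed simp
  qed
  moreover have "integral {0..r} (\<lambda>t. ?g w1 t - ?g w2 t) = integral {0..r} (?g w1) - integral {0..r} (?g w2)"
    by (intro integral_diff radial_flux_integrable w)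
  ultimately have "\<bar>integral {0..r} (?g w1) - integral {0..r} (?g w2)\<bar> \<le> I"
    using integral_unique[OF I] by simp
  then show ?thesis unfolding picard_step_def by linarith
qed

definition picard_iterate :: "real \<Rightarrow> nat \<Rightarrow> real \<Rightarrow> real" where
  "picard_iterate C m = (picard_step C ^^ m) (\<lambda>_. 1)"

lemma unit_valued_picard_iterate: "C \<ge> 0 \<Longrightarrow> unit_valued (picard_iterate C m)"
proof (induction m)
  case 0
  then show ?case by (simp add: picard_iterate_def unit_valued_def)
next
  case (Suc m)
  then show ?case by (simp add: picard_iterate_def unit_valued_picard_step)
qed

text \<open>Two functions with values in the unit interval differ by at most 1, and each step
  integrates \<open>C * t\<close> times the previous bound.\<close>

lemma picard_iterate_diff:
  assumes "C \<ge> 0" "r \<ge> 0"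
  shows "\<bar>picard_iterate C (Suc m) r - picard_iterate C m r\<bar> \<le> (C * r\<^sup>2 / 2) ^ m / fact m"
  using assms(2)
proof (induction m arbitrary: r)
  case 0
  then show ?case
    using unit_valued_picard_iterate[OF assms(1), of "Suc 0"]
    by (auto simp: picard_iterate_def unit_valued_def)
next
  case (Suc m)
  let ?D = "\<lambda>t. (C * t\<^sup>2 / 2) ^ m / fact m"
  have "\<bar>picard_step C (picard_iterate C (Suc m)) r - picard_step C (picard_iterate C m) r\<bar>
      \<le> (C * r\<^sup>2 / 2) ^ Suc m / fact (Suc m)"
  proof (rule picard_step_diff[where D = ?D])
    show "mono_on {0..r} ?D"
      using assms(1)
      by (intro mono_onI divide_right_mono power_mono mult_left_mono) auto
    have "((\<lambda>t. C * (t * ?D t)) has_integral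
        (C * r\<^sup>2 / 2) ^ Suc m / fact (Suc m) - (C * 0\<^sup>2 / 2) ^ Suc m / fact (Suc m)) {0..r}"
    proof (rule fundamental_theorem_of_calculus[OF Suc.prems])
      fix x
      have "((\<lambda>t. C * t\<^sup>2 / 2) has_real_derivative C * x) (at x within {0..r})"
        by (auto intro!: derivative_eq_intros)
      then have "((\<lambda>t. (C * t\<^sup>2 / 2) ^ Suc m / fact (Suc m)) has_real_derivative
          (1 + real m) * (C * x * (C * x\<^sup>2 / 2) ^ m) / fact (Suc m)) (at x within {0..r})"
        by (intro DERIV_cdivide DERIV_power_Suc)
      moreover have "(1 + real m) * (C * x * F) / fact (Suc m) = C * (x * (F / fact m))" for F :: real
        by (simp add: divide_simps)
      ultimately show "((\<lambda>t. (C * t\<^sup>2 / 2) ^ Suc m / fact (Suc m)) has_vector_derivative C * (x * ?D x))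
          (at x within {0..r})"
        by (simp only: has_real_derivative_iff_has_vector_derivative)
    qed
    then show "((\<lambda>t. C * (t * ?D t)) has_integral (C * r\<^sup>2 / 2) ^ Suc m / fact (Suc m)) {0..r}" by simp
  qed (use assms Suc unit_valued_picard_iterate in auto)
  then show ?case by (simp add: picard_iterate_def)
qed

text \<open>The differences are dominated by an exponential series, so the iterates converge
  uniformly on bounded intervals; the Lipschitz estimate with constant D passes the limit through
  the step.\<close>

lemma picard_fixpoint_exists:
  assumes C: "C \<ge> 0"
  shows "\<exists>w. unit_valued w \<and> (\<forall>r\<ge>0. w r = picard_step C w r)"
proof -
  let ?P = "picard_iterate C"
  define d where "d m r = ?P (Suc m) r - ?P m r" for m r
  define w where "w r = 1 + (\<Sum>m. d m r)" for r
  have P: "?P m r = 1 + (\<Sum>i<m. d i r)" for m r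
    using sum_lessThan_telescope[of "\<lambda>i. ?P i r" m] by (simp add: d_def picard_iterate_def)
  have unif: "uniform_limit {0..b} ?P w sequentially" for b
  proof -
    have "uniform_limit {0..b} (\<lambda>m r. \<Sum>i<m. d i r) (\<lambda>r. \<Sum>i. d i r) sequentially"
    proof (rule Weierstrass_m_test[where M = "\<lambda>m. (C * b\<^sup>2 / 2) ^ m / fact m"])
      show "summable (\<lambda>m. (C * b\<^sup>2 / 2) ^ m / fact m)"
        using summable_exp[of "C * b\<^sup>2 / 2"] by (simp only: divide_inverse mult.commute)
      fix m r assume "r \<in> {0..b}"
      then have r: "0 \<le> r" "r \<le> b" by auto
      have "\<bar>d m r\<bar> \<le> (C * r\<^sup>2 / 2) ^ m / fact m"
        unfolding d_def using picard_iterate_diff[OF C r(1)] .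
      also have "\<dots> \<le> (C * b\<^sup>2 / 2) ^ m / fact m"
        using C r by (intro divide_right_mono power_mono mult_left_mono) auto
      finally show "norm (d m r) \<le> (C * b\<^sup>2 / 2) ^ m / fact m" by simp
    qed
    then have "uniform_limit {0..b} (\<lambda>m r. 1 + (\<Sum>i<m. d i r)) (\<lambda>r. 1 + (\<Sum>i. d i r)) sequentially"
      by (intro uniform_limit_intros)
    then show ?thesis by (simp add: P[abs_def] w_def[abs_def])
  qed
  have lim: "(\<lambda>m. ?P m r) \<longlonglongrightarrow> w r" if "r \<ge> 0" for r
    using tendsto_uniform_limitI[OF unif[of r], of r] that by simp
  have uv: "unit_valued (?P m)" for m using unit_valued_picard_iterate[OF C] .
  have "continuous_on {0..} w"
  proof (rule continuous_on_nonneg_if_bounded)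
    fix b :: real
    have "continuous_on {0..b} (?P m)" for m
      using uv[of m] unfolding unit_valued_def by (auto intro: continuous_on_subset)
    then show "continuous_on {0..b} w"
      by (intro uniform_limit_theorem[OF _ unif]) auto
  qed
  moreover have "0 \<le> w r \<and> w r \<le> 1" if "r \<ge> 0" for r
    using uv that
    by (auto simp: unit_valued_def intro!: LIMSEQ_le_const[OF lim[OF that]] LIMSEQ_le_const2[OF lim[OF that]])
  ultimately have uw: "unit_valued w" by (simp add: unit_valued_def)
  have "w r = picard_step C w r" if r: "r \<ge> 0" for r
  proof (rule LIMSEQ_unique)
    show "(\<lambda>m. ?P (Suc m) r) \<longlonglongrightarrow> w r" using lim[OF r] by (rule LIMSEQ_Suc)
    show "(\<lambda>m. ?P (Suc m) r) \<longlonglongrightarrow> picard_step C w r"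
    proof (rule LIMSEQ_I)
      fix e :: real assume "e > 0"
      \<comment> \<open>\<open>C * r\<^sup>2 / 2\<close> is a Lipschitz constant of the step on
        \<open>{0..r}\<close>; the summand 1 keeps the denominator positive.\<close>
      define \<delta> where "\<delta> = e / (C * r\<^sup>2 + 1)"
      have pos: "C * r\<^sup>2 + 1 > 0" using C by (intro add_nonneg_pos) auto
      have \<delta>: "\<delta> > 0" "\<delta> * (C * r\<^sup>2) < e"
        using \<open>e > 0\<close> pos by (auto simp: \<delta>_def field_simps)
      have "eventually (\<lambda>m. \<forall>s\<in>{0..r}. dist (?P m s) (w s) < \<delta>) sequentially"
        using uniform_limitD[OF unif \<delta>(1)] .
      then obtain M where M: "\<And>m s. m \<ge> M \<Longrightarrow> s \<in> {0..r} \<Longrightarrow> dist (?P m s) (w s) < \<delta>"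
        unfolding eventually_sequentially by blast
      have "\<bar>picard_step C (?P m) r - picard_step C w r\<bar> < e" if "m \<ge> M" for m
      proof -
        have "((\<lambda>t. C * (t * \<delta>)) has_integral C * r\<^sup>2 / 2 * \<delta> - C * 0\<^sup>2 / 2 * \<delta>) {0..r}"
        proof (rule fundamental_theorem_of_calculus[OF r])
          fix x
          have "((\<lambda>t. C * t\<^sup>2 / 2 * \<delta>) has_real_derivative C * (x * \<delta>)) (at x within {0..r})"
            by (auto intro!: derivative_eq_intros)
          then show "((\<lambda>t. C * t\<^sup>2 / 2 * \<delta>) has_vector_derivative C * (x * \<delta>)) (at x within {0..r})"
            by (simp only: has_real_derivative_iff_has_vector_derivative)
        qed
        then have "((\<lambda>t. C * (t * \<delta>)) has_integral C * r\<^sup>2 / 2 * \<delta>) {0..r}" by simp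
        then have "\<bar>picard_step C (?P m) r - picard_step C w r\<bar> \<le> C * r\<^sup>2 / 2 * \<delta>"
          using M[OF that]
          by (intro picard_step_diff[where D = "\<lambda>_. \<delta>"] uv uw C r) (auto simp: dist_real_def mono_on_def less_imp_le)
        also have "\<dots> \<le> \<delta> * (C * r\<^sup>2)" using C \<delta> by simp
        finally show ?thesis using \<delta>(2) by simp
      qed
      then show "\<exists>M. \<forall>m\<ge>M. norm (?P (Suc m) r - picard_step C w r) < e"
        by (auto simp: picard_iterate_def intro!: exI[of _ M])
    qed
  qed
  then show ?thesis using uw by blast
qed

text \<open>Integrated form of the radial equation, with \<open>u = - v\<close> continued past its first zero.\<close>

lemma radial_volterra_exists:
  assumes C: "C \<ge> 0"
  shows "\<exists>v. unit_valued (\<lambda>t. max 0 (v t)) \<and> continuous_on {0..} v \<and> v 0 = 1 \<and>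
    (\<forall>t>0. (v has_real_derivative - (C * (t * radial_mean k n (\<lambda>s. max 0 (v s)) t))) (at t))"
proof -
  obtain w where w: "unit_valued w" "\<And>r. r \<ge> 0 \<Longrightarrow> w r = picard_step C w r"
    using picard_fixpoint_exists[OF C] by blast
  define v where "v r = 1 - integral {0..r} (\<lambda>t. C * (t * radial_mean k n w t))" for r
  \<comment> \<open>The fixed point w is the truncation of v, so both have the same means.\<close>
  have mean: "radial_mean k n (\<lambda>s. max 0 (v s)) t = radial_mean k n w t" for t
  proof -
    have "integral {0..t powr n} (\<lambda>s. max 0 (v (s powr (1 / n))) powr k) =
        integral {0..t powr n} (\<lambda>s. w (s powr (1 / n)) powr k)"
      using w(2) by (intro integral_cong) (simp add: picard_step_def v_def)
    then show ?thesis by (simp add: radial_mean_def)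
  qed
  have cont: "continuous_on {0..} v"
    unfolding v_def[abs_def]
    by (intro continuous_on_diff continuous_on_const continuous_on_integral_nonneg
        continuous_on_radial_flux w)
  moreover have "unit_valued (\<lambda>t. max 0 (v t))"
  proof -
    have "max 0 (v t) = w t" if "t \<ge> 0" for t using w(2)[OF that] by (simp add: picard_step_def v_def)
    moreover have "continuous_on {0..} (\<lambda>t. max 0 (v t))"
      using cont by (intro continuous_on_max continuous_on_const)
    ultimately show ?thesis using w(1) by (simp add: unit_valued_def)
  qed
  moreover have "(v has_real_derivative - (C * (t * radial_mean k n (\<lambda>s. max 0 (v s)) t))) (at t)"
    if "t > 0" for t
    using DERIV_diff[OF DERIV_const[of 1] DERIV_integral_nonneg[OF continuous_on_radial_flux[OF w(1), of C] that]]
    unfolding mean by (simp add: v_def[abs_def])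
  moreover have "v 0 = 1" by (simp add: v_def)
  ultimately show ?thesis by blast
qed

end

section \<open>Asymptotics of the binomial coefficient\<close>

lemma ln_Gamma_real_plus1:
  fixes x :: real
  assumes "x > 0"
  shows "ln_Gamma (x + 1) = ln_Gamma x + ln x"
proof -
  have "ln (Gamma (x + 1)) = ln (x * Gamma x)" using assms by (subst Gamma_plus1) auto
  also have "\<dots> = ln x + ln (Gamma x)" using assms Gamma_real_pos[OF assms] by (intro ln_mult_pos)
  finally show ?thesis using assms by (simp add: ln_Gamma_real_pos)
qed

text \<open>By the mean value theorem \<open>ln x\<close>, the increment of \<open>ln_Gamma\<close>
  from x to x + 1, is a value of the increasing function \<open>Digamma\<close> between these
  points.\<close>

lemma Digamma_real_bounds:
  fixes x :: real
  assumes "x > 0"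
  shows "Digamma x \<le> ln x" "ln x - 1 / x \<le> Digamma x"
proof -
  have "\<exists>z. x < z \<and> z < x + 1 \<and> ln_Gamma (x + 1) - ln_Gamma x = (x + 1 - x) * Digamma z"
    using assms by (intro MVT2) (auto intro!: derivative_eq_intros)
  then obtain z where z: "x < z" "z < x + 1" "ln x = Digamma z"
    using ln_Gamma_real_plus1[OF assms] by auto
  show "Digamma x \<le> ln x" using z assms by (auto intro: Digamma_real_mono)
  have "ln x \<le> Digamma (x + 1)" using z assms by (auto intro: Digamma_real_mono)
  then show "ln x - 1 / x \<le> Digamma x" using Digamma_plus1[of x] assms by simp
qed

text \<open>Integrates the Digamma bounds from 1. The logarithmic error disappears after division by
  k.\<close>

lemma ln_Gamma_real_bounds:
  fixes x :: real
  assumes "x \<ge> 1"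
  shows "ln_Gamma x \<le> x * ln x - x + 1" "x * ln x - x + 1 - ln x \<le> ln_Gamma x"
proof -
  have one: "ln_Gamma (1::real) = 0" by (simp add: ln_Gamma_real_pos)
  have "ln_Gamma x - (x * ln x - x) \<le> ln_Gamma 1 - (1 * ln 1 - 1)"
  proof (rule DERIV_nonpos_imp_nonincreasing[OF assms, of "\<lambda>x. ln_Gamma x - (x * ln x - x)"])
    fix s :: real assume "1 \<le> s" "s \<le> x"
    then show "\<exists>y. ((\<lambda>x. ln_Gamma x - (x * ln x - x)) has_real_derivative y) (at s) \<and> y \<le> 0"
      using Digamma_real_bounds[of s]
      by (intro exI[of _ "Digamma s - ln s"] conjI) (auto intro!: derivative_eq_intros)
  qed
  then show "ln_Gamma x \<le> x * ln x - x + 1" by (simp add: one)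
  have "ln_Gamma 1 - (1 * ln 1 - 1) + ln 1 \<le> ln_Gamma x - (x * ln x - x) + ln x"
  proof (rule DERIV_nonneg_imp_nondecreasing[OF assms, of "\<lambda>x. ln_Gamma x - (x * ln x - x) + ln x"])
    fix s :: real assume "1 \<le> s" "s \<le> x"
    then show "\<exists>y. ((\<lambda>x. ln_Gamma x - (x * ln x - x) + ln x) has_real_derivative y) (at s) \<and> 0 \<le> y"
      using Digamma_real_bounds[of s]
      by (intro exI[of _ "Digamma s - ln s + 1 / s"] conjI) (auto intro!: derivative_eq_intros)
  qed
  then show "x * ln x - x + 1 - ln x \<le> ln_Gamma x" by (simp add: one)
qed

text \<open>The endpoint 0 matters for \<alpha> = 1, where (n - k + 1)/k tends to 0.\<close>

lemma continuous_on_x_ln_x: "continuous_on {0..} (\<lambda>x::real. x * ln x)"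
  unfolding continuous_on_def
proof
  fix x :: real assume x: "x \<in> {0..}"
  show "((\<lambda>x. x * ln x) \<longlongrightarrow> x * ln x) (at x within {0..})"
  proof (cases "x = 0")
    case True
    have "((\<lambda>x::real. x * ln x) \<longlongrightarrow> 0) (at_right 0)" by real_asymp
    then show ?thesis using True by (simp add: at_within_Ici_at_right)
  next
    case False
    then show ?thesis using x by (intro tendsto_intros) auto
  qed
qed

text \<open>For a > 1 this is \<open>a powr a / (a - 1) powr (a - 1)\<close>. The exponential form
  gives the correct value 1 at a = 1, where \<open>0 powr 0\<close> would be 0.\<close>

definition binom_rate :: "real \<Rightarrow> real" where
  "binom_rate a = exp (a * ln a - (a - 1) * ln (a - 1))"

lemma real_binom_root_tendsto:
  fixes n k :: "nat \<Rightarrow> real"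
  assumes kn: "eventually (\<lambda>i. 1 \<le> k i \<and> k i \<le> n i) sequentially"
    and k: "filterlim k at_top sequentially"
    and a: "(\<lambda>i. n i / k i) \<longlonglongrightarrow> a"
  shows "(\<lambda>i. real_binom (n i - 1) (k i - 1) powr (1 / k i)) \<longlonglongrightarrow> binom_rate a"
proof -
  define e where "e x = ln_Gamma x - (x * ln x - x + 1)" for x :: real
  have e: "\<bar>e x\<bar> \<le> ln x" if "x \<ge> 1" for x
    using ln_Gamma_real_bounds[OF that] that by (simp add: e_def)
  define m where "m i = n i - k i + 1" for i
  \<comment> \<open>The logarithm of the root. Since \<open>m = n - k + 1\<close>, the linear terms
    and constants cancel, and splitting \<open>ln k\<close> off each logarithm leaves it with
    coefficient \<open>n - k - m = -1\<close>.\<close>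
  define T where "T i = n i / k i * ln (n i / k i) - m i / k i * ln (m i / k i) - ln (k i) / k i
      + (e (n i) - e (k i) - e (m i)) / k i" for i
  have "1 \<le> a"
    using kn by (intro tendsto_lowerbound[OF a]) (auto elim!: eventually_mono)
  have lnk: "(\<lambda>i. ln (k i) / k i) \<longlonglongrightarrow> 0"
  proof (rule filterlim_compose[OF _ k])
    show "((\<lambda>x::real. ln x / x) \<longlongrightarrow> 0) at_top" by real_asymp
  qed
  have invk: "(\<lambda>i. 1 / k i) \<longlonglongrightarrow> 0"
    using tendsto_inverse_0_at_top[OF k] by (simp add: divide_inverse)
  have mk: "(\<lambda>i. m i / k i) \<longlonglongrightarrow> a - 1"
  proof (rule Lim_transform_eventually)
    show "(\<lambda>i. n i / k i - 1 + 1 / k i) \<longlonglongrightarrow> a - 1"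
      using tendsto_add[OF tendsto_diff[OF a tendsto_const[of 1]] invk] by simp
    show "eventually (\<lambda>i. n i / k i - 1 + 1 / k i = m i / k i) sequentially"
      using kn by eventually_elim (simp add: m_def field_simps)
  qed
  have xlnx: "(\<lambda>i. f i * ln (f i)) \<longlonglongrightarrow> b * ln b"
    if "f \<longlonglongrightarrow> b" "eventually (\<lambda>i. f i \<ge> 0) sequentially" "b \<ge> 0" for f :: "nat \<Rightarrow> real" and b
    using continuous_on_tendsto_compose[OF continuous_on_x_ln_x that(1)] that by auto
  have lnn: "(\<lambda>i. ln (n i) / k i) \<longlonglongrightarrow> 0"
  proof (rule Lim_transform_eventually)
    show "(\<lambda>i. ln (n i / k i) * (1 / k i) + ln (k i) / k i) \<longlonglongrightarrow> 0"
    proof -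
      have "(\<lambda>i. ln (n i / k i) * (1 / k i) + ln (k i) / k i) \<longlonglongrightarrow> ln a * 0 + 0"
        using \<open>1 \<le> a\<close> by (intro tendsto_intros a invk lnk) auto
      then show ?thesis by simp
    qed
    show "eventually (\<lambda>i. ln (n i / k i) * (1 / k i) + ln (k i) / k i = ln (n i) / k i) sequentially"
      using kn by eventually_elim (simp add: ln_div field_simps)
  qed
  have err: "(\<lambda>i. (e (n i) - e (k i) - e (m i)) / k i) \<longlonglongrightarrow> 0"
  proof (rule Lim_null_comparison)
    show "eventually (\<lambda>i. norm ((e (n i) - e (k i) - e (m i)) / k i) \<le> 3 * (ln (n i) / k i)) sequentially"
      using kn
    proof eventually_elim
      case (elim i)
      then have "1 \<le> m i" "m i \<le> n i" by (auto simp: m_def)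
      then have "ln (m i) \<le> ln (n i)" "ln (k i) \<le> ln (n i)" using elim by auto
      then have "\<bar>e (n i) - e (k i) - e (m i)\<bar> \<le> 3 * ln (n i)"
        using e[of "n i"] e[of "k i"] e[of "m i"] \<open>1 \<le> m i\<close> elim by linarith
      then show ?case using elim by (simp add: divide_right_mono)
    qed
    show "(\<lambda>i. 3 * (ln (n i) / k i)) \<longlonglongrightarrow> 0"
      using tendsto_mult[OF tendsto_const[of 3] lnn] by simp
  qed
  have "T \<longlonglongrightarrow> a * ln a - (a - 1) * ln (a - 1) - 0 + 0"
    unfolding T_def using \<open>1 \<le> a\<close> kn
    by (intro tendsto_add tendsto_diff err lnk xlnx a mk)
       (auto elim!: eventually_mono simp: m_def)
  then have "(\<lambda>i. exp (T i)) \<longlonglongrightarrow> binom_rate a"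
    unfolding binom_rate_def by (intro tendsto_intros) simp
  moreover have "eventually (\<lambda>i. exp (T i) = real_binom (n i - 1) (k i - 1) powr (1 / k i)) sequentially"
    using kn
  proof eventually_elim
    case (elim i)
    have pos: "k i > 0" "n i > 0" "m i > 0" using elim by (auto simp: m_def)
    have "real_binom (n i - 1) (k i - 1) = exp (ln_Gamma (n i) - ln_Gamma (k i) - ln_Gamma (m i))"
      using pos by (simp add: real_binom_def Gamma_real_pos_exp m_def exp_diff)
    then have "real_binom (n i - 1) (k i - 1) powr (1 / k i) =
        exp ((ln_Gamma (n i) - ln_Gamma (k i) - ln_Gamma (m i)) / k i)"
      by (simp add: powr_def)
    also have "(ln_Gamma (n i) - ln_Gamma (k i) - ln_Gamma (m i)) / k i = T i"
      unfolding T_def e_def using pos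
      by (simp add: ln_div m_def field_simps)
    finally show ?case by simp
  qed
  ultimately show ?thesis by (rule Lim_transform_eventually)
qed

section \<open>Existence of eigenpairs\<close>

lemma volterra_antimono:
  fixes v :: "real \<Rightarrow> real"
  assumes "C \<ge> 0" "continuous_on {0..} v"
    and v': "\<And>t. t > 0 \<Longrightarrow> (v has_real_derivative - (C * (t * radial_mean k n w t))) (at t)"
    and st: "0 \<le> s" "s \<le> t"
  shows "v t \<le> v s"
proof (rule DERIV_nonpos_imp_decreasing_open[of s t v])
  fix x assume "s < x" "x < t"
  moreover have "0 \<le> C * (x * radial_mean k n w x)"
    using assms calculation by (auto simp: radial_mean_def intro!: mult_nonneg_nonneg)
  ultimately show "\<exists>y. (v has_real_derivative y) (at x) \<and> y \<le> 0"
    using v'[of x] st by (intro exI[of _ "- (C * (x * radial_mean k n w x))"]) auto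
next
  show "continuous_on {s..t} v" using assms by (auto intro: continuous_on_subset)
qed (use st in auto)

text \<open>Shrinking the ball of radius R to the unit ball multiplies the eigenvalue 1 by
  \<open>R\<^sup>2\<close>. The value of v at R is left open: the result serves both for arbitrary R
  while v is supposed never to vanish and for R the first zero.\<close>

lemma volterra_radial_solution:
  fixes v :: "real \<Rightarrow> real"
  defines "w \<equiv> \<lambda>t. max 0 (v t)"
  assumes kn: "1 \<le> k" "k \<le> n" and C: "C > 0" "C powr k * (n / k) * real_binom (n - 1) (k - 1) = 1"
    and w: "unit_valued w" and cont: "continuous_on {0..} v" and v0: "v 0 = 1"
    and "\<forall>t>0. (v has_real_derivative - (C * (t * radial_mean k n w t))) (at t)"
    and R: "R > 0" and "\<forall>t\<in>{0..<R}. v t > 0"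
  defines "u \<equiv> \<lambda>r. - v (R * r)"
  shows "alpha_convex (n / k) u"
    and "0 < r \<Longrightarrow> r < 1 \<Longrightarrow> deriv u r > 0"
    and "0 < r \<Longrightarrow> r < 1 \<Longrightarrow> radial_hessian k n u r = rpow (- R\<^sup>2 * u r) k"
    and "(u \<longlongrightarrow> -1) (at_right 0)"
proof -
  let ?a = "n / k"
  have v': "(v has_real_derivative - (C * (t * radial_mean k n w t))) (at t)" if "t > 0" for t
    using assms that by blast
  have pos: "v t > 0" if "0 \<le> t" "t < R" for t using assms that by auto
  have n: "n > 0" using kn by simp
  define N where "N r = radial_mean k n w (R * r)" for r
  have Rr: "0 < R * r" "R * r < R" "w (R * r) = v (R * r)" "v (R * r) > 0" if "0 < r" "r < 1" for r
    using R that pos[of "R * r"] by (auto simp: w_def)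
  have N: "N r > 0" "N r \<le> 1" if r: "0 < r" "r < 1" for r
  proof -
    have "v (R * r) \<le> N r"
      unfolding N_def
    proof (rule radial_mean_ge[OF kn(1) n w Rr(1)[OF r]])
      show "0 \<le> v (R * r)" using Rr[OF r] by simp
      show "v (R * r) \<le> w s" if "0 \<le> s" "s \<le> R * r" for s
        using volterra_antimono[OF _ cont v', of s "R * r"] C(1) that by (simp add: w_def)
    qed
    then show "N r > 0" using Rr[OF r] by simp
    show "N r \<le> 1" unfolding N_def by (rule radial_mean_le_1[OF kn(1) n w Rr(1)[OF r]])
  qed
  \<comment> \<open>\<open>U1\<close> and \<open>U2\<close> are the first and second derivatives of
    u.\<close>
  define U1 where "U1 r = R\<^sup>2 * C * (r * N r)" for r
  define U2 where "U2 r = R\<^sup>2 * C * ((1 - ?a) * N r + ?a * (v (R * r) powr k * N r powr (1 - k)))" for r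
  have D0: "(u has_real_derivative U1 r) (at r)" if r: "0 < r" for r
  proof -
    have "((\<lambda>r. v (R * r)) has_real_derivative - (C * ((R * r) * N r)) * R) (at r)"
      unfolding N_def using v'[of "R * r"] R r
      by (intro DERIV_chain2[where f = v and g = "\<lambda>r. R * r"]) (auto intro!: derivative_eq_intros)
    then have "(u has_real_derivative - (- (C * ((R * r) * N r)) * R)) (at r)"
      unfolding u_def by (rule DERIV_minus)
    then show ?thesis by (simp add: U1_def power2_eq_square mult_ac)
  qed
  have d1: "deriv u r = U1 r" if "0 < r" for r using D0[OF that] by (rule DERIV_imp_deriv)
  have DN: "(N has_real_derivative ?a * (v (R * r) powr k * N r powr (1 - k) - N r) / r) (at r)"
    if r: "0 < r" "r < 1" for r
  proof -
    have "(radial_mean k n w has_real_derivative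
        ?a * (w (R * r) powr k * N r powr (1 - k) - N r) / (R * r)) (at (R * r))"
      using DERIV_radial_mean[OF kn(1) n w Rr(1)[OF r]] N[OF r] by (simp add: N_def)
    then have "(N has_real_derivative
        ?a * (w (R * r) powr k * N r powr (1 - k) - N r) / (R * r) * R) (at r)"
      unfolding N_def[abs_def]
      by (intro DERIV_chain2[where f = "radial_mean k n w" and g = "\<lambda>r. R * r"])
         (auto intro!: derivative_eq_intros)
    then show ?thesis using R Rr(3)[OF r] by simp
  qed
  have D1: "(U1 has_real_derivative U2 r) (at r)" if r: "0 < r" "r < 1" for r
  proof -
    have "(U1 has_real_derivative R\<^sup>2 * C *
        (1 * N r + ?a * (v (R * r) powr k * N r powr (1 - k) - N r) / r * r)) (at r)"
      unfolding U1_def[abs_def] by (intro DERIV_cmult DERIV_mult DERIV_ident DN r)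
    moreover have "1 * N r + ?a * (X - N r) / r * r = (1 - ?a) * N r + ?a * X" for X
    proof -
      have "?a * (X - N r) / r * r = ?a * (X - N r)" using r by simp
      then show ?thesis by (simp only:) (simp add: algebra_simps)
    qed
    ultimately show ?thesis unfolding U2_def by simp
  qed
  have D1': "(deriv u has_real_derivative U2 r) (at r)" if r: "0 < r" "r < 1" for r
    by (rule has_field_derivative_transform_within_open[OF D1[OF r], of "{0<..}"]) (use d1 r in auto)
  have d2: "deriv (deriv u) r = U2 r" if "0 < r" "r < 1" for r
    using D1'[OF that] by (rule DERIV_imp_deriv)
  \<comment> \<open>The terms linear in \<open>N r\<close> cancel; both convexity and the eigenvalue
    equation are read off from this identity.\<close>
  have pointwise: "U2 r + (?a - 1) * (U1 r / r) = R\<^sup>2 * C * (?a * (v (R * r) powr k * N r powr (1 - k)))"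
    if "0 < r" for r
  proof -
    have "U1 r / r = R\<^sup>2 * C * N r" using that by (simp add: U1_def)
    then show ?thesis by (simp add: U2_def algebra_simps)
  qed
  have "continuous_on {0<..<1} U2"
  proof (rule continuous_at_imp_continuous_on, rule ballI)
    fix r :: real assume "r \<in> {0<..<1}"
    then have r: "0 < r" "r < 1" by auto
    have cN: "isCont N r" using DN[OF r] by (rule DERIV_isCont)
    have "isCont (\<lambda>r. - u r) r" using D0[OF r(1)] by (intro continuous_minus DERIV_isCont)
    then have cv: "isCont (\<lambda>r. v (R * r)) r" by (simp add: u_def)
    have "isCont (\<lambda>r. v (R * r) powr k) r" "isCont (\<lambda>r. N r powr (1 - k)) r"
      using cN cv Rr(4)[OF r] N(1)[OF r] unfolding isCont_def by (auto intro!: tendsto_powr)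
    then show "isCont U2 r"
      unfolding U2_def[abs_def] by (intro continuous_add continuous_mult continuous_const cN)
  qed
  then have "continuous_on {0<..<1} (deriv (deriv u))"
    using d2 by (subst continuous_on_cong[OF refl, of _ _ U2]) auto
  moreover have "u differentiable_on {0<..<1}" "deriv u differentiable_on {0<..<1}"
    unfolding differentiable_on_def real_differentiable_def
    by (meson D0 D1' has_field_derivative_at_within greaterThanLessThan_iff)+
  ultimately have C2: "C2_on {0<..<1} u" by (simp add: C2_on_def)
  have "eventually (\<lambda>r. r \<in> {0<..<1}) (at_right (0::real))"
    by (rule eventually_at_right_real) simp
  then have "eventually (\<lambda>r. ereal (deriv u r / r) \<le> ereal (R\<^sup>2 * C)) (at_right 0)"
  proof eventually_elim
    case (elim r)
    then have "deriv u r / r = R\<^sup>2 * C * N r" by (simp add: d1 U1_def)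
    moreover have "R\<^sup>2 * C * N r \<le> R\<^sup>2 * C * 1"
      using N[of r] elim C(1) by (intro mult_left_mono) auto
    ultimately show ?case by simp
  qed
  then have "Limsup (at_right 0) (\<lambda>r. ereal (deriv u r / r)) \<le> ereal (R\<^sup>2 * C)"
    by (rule Limsup_bounded)
  then have "Limsup (at_right 0) (\<lambda>r. ereal (deriv u r / r)) < \<infinity>"
    by (rule le_less_trans) simp
  moreover have d1_pos: "deriv u r > 0" if "0 < r" "r < 1" for r
    using d1[of r] N[OF that] that R C(1) by (simp add: U1_def)
  moreover have "deriv (deriv u) r + (?a - 1) * (deriv u r / r) \<ge> 0" if "0 < r" "r < 1" for r
    using pointwise[of r] that R C(1) kn by (simp add: d1 d2)
  ultimately show "alpha_convex ?a u"
    using C2 by (auto simp: alpha_convex_def less_imp_le)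
  show "0 < r \<Longrightarrow> r < 1 \<Longrightarrow> deriv u r > 0" using d1_pos .
  show "radial_hessian k n u r = rpow (- R\<^sup>2 * u r) k" if r: "0 < r" "r < 1"
  proof -
    define c where "c = real_binom (n - 1) (k - 1)"
    define V where "V = v (R * r)"
    have V: "V > 0" using Rr[OF r] by (simp add: V_def)
    have q: "deriv u r / r = R\<^sup>2 * C * N r" using r by (simp add: d1 U1_def)
    have "R\<^sup>2 * C * N r > 0" using R C(1) N[OF r] by simp
    then have "radial_hessian k n u r =
        c * (R\<^sup>2 * C * N r) powr (k - 1) * (U2 r + (?a - 1) * (U1 r / r))"
      using kn unfolding radial_hessian_def q c_def d2[OF r] d1[OF r(1), symmetric]
      by (auto simp: rpow_def diff_divide_distrib)
    also have "\<dots> = c * (R\<^sup>2 * C * N r) powr (k - 1) * (R\<^sup>2 * C * (?a * (V powr k * N r powr (1 - k))))"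
      using pointwise[OF r(1)] by (simp add: V_def)
    also have "(R\<^sup>2 * C * N r) powr (k - 1) = (R\<^sup>2) powr (k - 1) * C powr (k - 1) * N r powr (k - 1)"
      by (simp add: powr_mult)
    also have "c * (\<dots>) * (R\<^sup>2 * C * (?a * (V powr k * N r powr (1 - k)))) =
        ((R\<^sup>2) powr (k - 1) * R\<^sup>2) * ((C powr (k - 1) * C) * ?a * c) *
          (N r powr (k - 1) * N r powr (1 - k)) * V powr k"
      by (simp only: mult_ac)
    also have "(R\<^sup>2) powr (k - 1) * R\<^sup>2 = (R\<^sup>2) powr k"
      using R powr_add[of "R\<^sup>2" "k - 1" 1] by simp
    also have "C powr (k - 1) * C = C powr k" using C(1) powr_add[of C "k - 1" 1] by simp
    also have "N r powr (k - 1) * N r powr (1 - k) = 1" using N[OF r] by (simp add: powr_add[symmetric])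
    also have "C powr k * ?a * c = 1" using C(2) unfolding c_def .
    finally have "radial_hessian k n u r = (R\<^sup>2) powr k * V powr k" by simp
    then show ?thesis using kn R by (simp add: rpow_def u_def V_def powr_mult)
  qed
  have "((\<lambda>r. v (R * r)) \<longlongrightarrow> v 0) (at_right 0)"
  proof (rule continuous_on_tendsto_compose[OF cont])
    show "((\<lambda>r. R * r) \<longlongrightarrow> 0) (at_right 0)" by (auto intro!: tendsto_eq_intros)
    show "eventually (\<lambda>r. R * r \<in> {0..}) (at_right 0)"
      using R by (auto simp: eventually_at_filter)
  qed simp
  then show "(u \<longlongrightarrow> -1) (at_right 0)" unfolding u_def v0 by (rule tendsto_minus)
qed

text \<open>If v stayed positive, every R would give a Riccati solution with rate proportional to
  \<open>R\<^sup>2\<close>, against \<open>riccati_rate_le\<close>. Rescaling at the first zero R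
  yields an eigenpair with eigenvalue \<open>R\<^sup>2\<close>.\<close>

lemma radial_eigenpair_exists:
  assumes kn: "1 \<le> k" "k \<le> n"
  shows "\<exists>u l. radial_eigenpair k n u l"
proof -
  have n: "n > 0" using kn by simp
  define c where "c = real_binom (n - 1) (k - 1)"
  have c: "c > 0" using real_binom_pos[OF kn] by (simp add: c_def)
  \<comment> \<open>Chosen so that the integrated equation corresponds to eigenvalue 1.\<close>
  define C where "C = (k / (n * c)) powr (1 / k)"
  have C: "C > 0" "C powr k * (n / k) * real_binom (n - 1) (k - 1) = 1"
    using c n kn by (auto simp: C_def powr_powr simp flip: c_def)
  obtain v where v: "unit_valued (\<lambda>t. max 0 (v t))" "continuous_on {0..} v" "v 0 = 1"
      "\<forall>t>0. (v has_real_derivative - (C * (t * radial_mean k n (\<lambda>s. max 0 (v s)) t))) (at t)"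
    using radial_volterra_exists[OF kn(1) n, of C] C(1) by (meson less_imp_le)
  note sol = volterra_radial_solution[OF kn C v]
  have "\<exists>t\<ge>0. v t \<le> 0"
  proof (rule ccontr)
    assume "\<not> ?thesis"
    then have pos: "v t > 0" if "t \<ge> 0" for t using that by force
    define K where "K = (n / k) powr (1 / k) * critical_rate (n / k)"
    have bound: "R\<^sup>2 \<le> K * c powr (1 / k)" if R: "R > 0" for R
    proof -
      have "\<forall>t\<in>{0..<R}. v t > 0" using pos by simp
      note s = sol[OF R this]
      let ?u = "\<lambda>r. - v (R * r)"
      have "riccati_solution k (n / k) (radial_rate k n (R\<^sup>2)) (radial_slope ?u)"
      proof (rule riccati_solution_radial_slope[OF kn])
        show "C2_on {0<..<1} ?u" using s(1) by (simp add: alpha_convex_def)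
      qed (use s R pos in auto)
      then have "radial_rate k n (R\<^sup>2) \<le> K"
        unfolding K_def using kn R c
        by (intro riccati_rate_le) (auto simp: radial_rate_def simp flip: c_def)
      then show ?thesis using c by (simp add: radial_rate_def divide_le_eq flip: c_def)
    qed
    define R where "R = sqrt (\<bar>K * c powr (1 / k)\<bar> + 1)"
    have "R > 0" by (simp add: R_def add_nonneg_pos)
    then have "R\<^sup>2 \<le> K * c powr (1 / k)" by (rule bound)
    then show False by (simp add: R_def)
  qed
  then obtain t1 where t1: "t1 \<ge> 0" "v t1 \<le> 0" by blast
  \<comment> \<open>The minimum of this compact set is the first zero of v.\<close>
  define S where "S = {0..t1} \<inter> v -` {..0}"
  have "continuous_on {0..t1} v" using v(2) by (rule continuous_on_subset) auto
  then have "closed S" unfolding S_def by (intro continuous_closed_preimage) auto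
  then have "compact S"
    using compact_Int_closed[of "{0..t1}" S] by (simp add: S_def Int_absorb1 flip: Int_assoc)
  moreover have "S \<noteq> {}" using t1 by (auto simp: S_def)
  ultimately obtain R where R: "R \<in> S" "\<And>s. s \<in> S \<Longrightarrow> R \<le> s"
    using compact_attains_inf[of S] by auto
  have vR: "v R \<le> 0" "0 \<le> R" "R \<le> t1" using R(1) by (auto simp: S_def)
  have "R \<noteq> 0" using vR v(3) by auto
  then have R0: "R > 0" using vR by simp
  have pos: "v t > 0" if "0 \<le> t" "t < R" for t
  proof (rule ccontr)
    assume "\<not> ?thesis"
    then have "t \<in> S" using that vR by (auto simp: S_def)
    then show False using R(2) that by force
  qed
  have "isCont v R" using v(4) R0 DERIV_isCont by blast
  then have lim: "(v \<longlongrightarrow> v R) (at R)" by (simp add: isCont_def)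
  have "0 \<le> v R"
  proof (rule tendsto_left_ge[of v "v R" R 0])
    show "(v \<longlongrightarrow> v R) (at_left R)" using lim by (rule tendsto_within_subset) simp
    show "0 \<le> v s" if "0 < s" "s < R" for s using pos[of s] that by simp
  qed (fact R0)
  then have vR0: "v R = 0" using vR by simp
  let ?u = "\<lambda>r. - v (R * r)"
  have "isCont (\<lambda>r. v (R * r)) 1"
    using \<open>isCont v R\<close> by (intro isCont_o2[where g = v and f = "\<lambda>r. R * r"]) auto
  then have "((\<lambda>r. v (R * r)) \<longlongrightarrow> v (R * 1)) (at_left 1)"
    unfolding isCont_def by (rule tendsto_within_subset) simp
  then have "(?u \<longlongrightarrow> 0) (at_left 1)" using tendsto_minus[of "\<lambda>r. v (R * r)"] vR0 by fastforce
  moreover have "\<forall>t\<in>{0..<R}. v t > 0" using pos by simp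
  note sol[OF R0 this]
  ultimately have "radial_eigenpair k n ?u (R\<^sup>2)"
    using R0 by (simp add: radial_eigenpair_def)
  then show ?thesis by blast
qed

section \<open>The limit of the eigenvalues\<close>

text \<open>Existence and uniqueness together make the definite description meaningful.\<close>

lemma radial_eigenvalue_eigenpair:
  assumes kn: "1 \<le> k" "k \<le> n"
  shows "\<exists>u. radial_eigenpair k n u (radial_eigenvalue k n)"
proof -
  have "\<exists>!l. \<exists>u. radial_eigenpair k n u l"
    using radial_eigenpair_exists[OF kn] radial_eigenpair_unique[OF kn] by blast
  then show ?thesis unfolding radial_eigenvalue_def by (rule theI')
qed

text \<open>Away from 1 and 2 this is the closed formula. There the regular values of the two
  factors, 1 and 4 for a = 1, 4 and 2e for a = 2, reproduce the prescribed limits.\<close>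

lemma binom_rate_critical_rate:
  assumes "a \<ge> 1"
  shows "binom_rate a * critical_rate a = limit_value a"
proof -
  have rate: "critical_rate a = a * exp (2 * critical_exponent a)"
    using exp_of_nat_mult[of 2 "critical_exponent a"]
    by (simp add: critical_rate_def critical_radius_def exp_minus field_simps)
  consider "a = 1" | "a = 2" | "a \<noteq> 1" "a \<noteq> 2" by blast
  then show ?thesis
  proof cases
    case 1
    have "exp (2 * ln 2) = (4::real)" using exp_of_nat_mult[of 2 "ln (2::real)"] by simp
    then show ?thesis
      using 1 rate by (simp add: binom_rate_def critical_exponent_def limit_value_def)
  next
    case 2
    have "exp (2 * ln 2) = (4::real)" using exp_of_nat_mult[of 2 "ln (2::real)"] by simp
    then show ?thesis
      using 2 rate by (simp add: binom_rate_def critical_exponent_def limit_value_def mult.commute)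
  next
    case 3
    have "binom_rate a = a powr a / (a - 1) powr (a - 1)"
      using assms 3 by (simp add: binom_rate_def powr_def exp_diff)
    moreover have "a powr (a + 1) = a powr a * a" using assms by (simp add: powr_add)
    moreover have "(2 / a) powr (2 / (2 - a)) = exp (2 * critical_exponent a)"
      using assms 3 by (simp add: powr_def critical_exponent_def)
    ultimately show ?thesis using 3 by (simp add: rate limit_value_def limit_expr_def)
  qed
qed

theorem theorem1p1:
  fixes n k :: "nat \<Rightarrow> real" and \<alpha> :: real
  assumes "\<And>i. i \<ge> 1 \<Longrightarrow> 1 \<le> k i \<and> k i \<le> n i"
    and "filterlim n at_top sequentially"
    and "(\<lambda>i. n i / k i) \<longlonglongrightarrow> \<alpha>"
  shows "(\<lambda>i. radial_eigenvalue (k i) (n i)) \<longlonglongrightarrow> limit_value \<alpha>"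
proof -
  have kn: "eventually (\<lambda>i. 1 \<le> k i \<and> k i \<le> n i) sequentially"
    using assms(1) by (auto simp: eventually_sequentially)
  have \<alpha>: "\<alpha> \<ge> 1"
    using kn by (intro tendsto_lowerbound[OF assms(3)]) (auto elim!: eventually_mono)
  \<comment> \<open>The ratio n/k is eventually below \<open>\<alpha> + 1\<close>, so k grows with
    n.\<close>
  have k: "filterlim k at_top sequentially"
  proof (rule filterlim_at_top_mono)
    have "eventually (\<lambda>i. n i / k i < \<alpha> + 1) sequentially"
      using assms(3) by (intro order_tendstoD) auto
    with kn show "eventually (\<lambda>i. n i * (1 / (\<alpha> + 1)) \<le> k i) sequentially"
      by eventually_elim (use \<alpha> in \<open>simp add: field_simps\<close>)
    show "filterlim (\<lambda>i. n i * (1 / (\<alpha> + 1))) at_top sequentially"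
      using \<alpha> by (intro filterlim_at_top_mult_tendsto_pos[OF tendsto_const _ assms(2)]) auto
  qed
  define M where "M i = radial_rate (k i) (n i) (radial_eigenvalue (k i) (n i))" for i
  \<comment> \<open>The margin must tend to 0 while \<open>(1 + \<eta>) powr (- k)\<close> also
    does; this choice makes \<open>k * \<eta>\<close> grow like the square root of k.\<close>
  define \<eta> where "\<eta> i = 1 / sqrt (k i)" for i
  have \<eta>: "\<eta> \<longlonglongrightarrow> 0"
    unfolding \<eta>_def
  proof (rule filterlim_compose[OF _ k])
    show "((\<lambda>x. 1 / sqrt x) \<longlongrightarrow> 0) at_top" by real_asymp
  qed
  have drop: "(\<lambda>i. (1 + \<eta> i) powr (- k i)) \<longlonglongrightarrow> 0"
    unfolding \<eta>_def
  proof (rule filterlim_compose[OF _ k])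
    show "((\<lambda>x. (1 + 1 / sqrt x) powr (- x)) \<longlongrightarrow> 0) at_top" by real_asymp
  qed
  have crit: "isCont critical_rate \<alpha>" using continuous_critical_rate \<alpha> by simp
  have upper: "(\<lambda>i. (n i / k i) powr (1 / k i) * critical_rate (n i / k i)) \<longlonglongrightarrow> critical_rate \<alpha>"
  proof -
    have "(\<lambda>i. 1 / k i) \<longlonglongrightarrow> 0"
      using tendsto_inverse_0_at_top[OF k] by (simp add: divide_inverse)
    then have "(\<lambda>i. (n i / k i) powr (1 / k i) * critical_rate (n i / k i)) \<longlonglongrightarrow> \<alpha> powr 0 * critical_rate \<alpha>"
      using \<alpha> by (intro tendsto_mult tendsto_powr assms(3) isCont_tendsto_compose[OF crit]) auto
    then show ?thesis using \<alpha> by simp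
  qed
  have lower: "(\<lambda>i. critical_rate (n i / k i - (1 + \<eta> i) powr (- k i)) / (1 + \<eta> i)) \<longlonglongrightarrow> critical_rate \<alpha>"
  proof -
    have "(\<lambda>i. n i / k i - (1 + \<eta> i) powr (- k i)) \<longlonglongrightarrow> \<alpha>"
      using tendsto_diff[OF assms(3) drop] by simp
    then have "(\<lambda>i. critical_rate (n i / k i - (1 + \<eta> i) powr (- k i)) / (1 + \<eta> i)) \<longlonglongrightarrow> critical_rate \<alpha> / (1 + 0)"
      by (intro tendsto_divide isCont_tendsto_compose[OF crit] tendsto_add tendsto_const \<eta>) auto
    then show ?thesis by simp
  qed
  have "M \<longlonglongrightarrow> critical_rate \<alpha>"
  proof (rule tendsto_sandwich[OF _ _ lower upper])
    show "eventually (\<lambda>i. M i \<le> (n i / k i) powr (1 / k i) * critical_rate (n i / k i)) sequentially"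
      using kn
    proof eventually_elim
      case (elim i)
      then show ?case
        unfolding M_def using radial_eigenvalue_eigenpair[of "k i" "n i"] radial_eigenpair_rate_bounds(1)
        by blast
    qed
    show "eventually (\<lambda>i. critical_rate (n i / k i - (1 + \<eta> i) powr (- k i)) / (1 + \<eta> i) \<le> M i) sequentially"
      using kn
    proof eventually_elim
      case (elim i)
      have "\<eta> i > 0" using elim by (simp add: \<eta>_def)
      moreover obtain u where "radial_eigenpair (k i) (n i) u (radial_eigenvalue (k i) (n i))"
        using radial_eigenvalue_eigenpair[of "k i" "n i"] elim by blast
      ultimately have "critical_rate (n i / k i - (1 + \<eta> i) powr (- k i)) \<le> (1 + \<eta> i) * M i"
        unfolding M_def using radial_eigenpair_rate_bounds(2) elim by blast
      then show ?case using \<open>\<eta> i > 0\<close> by (simp add: divide_le_eq mult.commute)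
    qed
  qed
  then have "(\<lambda>i. real_binom (n i - 1) (k i - 1) powr (1 / k i) * M i) \<longlonglongrightarrow> binom_rate \<alpha> * critical_rate \<alpha>"
    by (intro tendsto_mult real_binom_root_tendsto kn k assms(3))
  moreover have "eventually (\<lambda>i. real_binom (n i - 1) (k i - 1) powr (1 / k i) * M i =
      radial_eigenvalue (k i) (n i)) sequentially"
    using kn
  proof eventually_elim
    case (elim i)
    then have "real_binom (n i - 1) (k i - 1) > 0" by (intro real_binom_pos) auto
    then show ?case by (simp add: M_def radial_rate_def)
  qed
  ultimately have "(\<lambda>i. radial_eigenvalue (k i) (n i)) \<longlonglongrightarrow> binom_rate \<alpha> * critical_rate \<alpha>"
    by (rule Lim_transform_eventually)
  then show ?thesis using binom_rate_critical_rate[OF \<alpha>] by simp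
qed

end
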